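(* Let $\mathbb{F}$ be an arbitrary field, $p\in\mathbb{F}[x]$ a monic irreducible polynomial with $\deg(p)=s$ and companion matrix $C$, and let $W$ be the generalized Weyr matrix associated with $p$ and the generalized Segre characteristic $\alpha=(\alpha_1,\ldots,\alpha_m)$. Let $\tau=(\tau_1,\ldots,\tau_{\alpha_1})$ be the conjugate partition of $\alpha$. Then, if $K\in Z(W)$, $$K=\begin{bmatrix} K_{1,1}&K_{1,2}&\ldots&K_{1,\alpha_1-1}&K_{1,\alpha_1}\\ 0&K_{2,2}&\ldots&K_{2,\alpha_1-1}&K_{2,\alpha_1}\\ \vdots&\vdots&\ddots&\vdots&\vdots\\ 0&0&\ldots&K_{\alpha_1-1,\alpha_1-1}&K_{\alpha_1-1,\alpha_1}\\ 0&0&\ldots&0&K_{\alpha_1,\alpha_1} \end{bmatrix},\qquad K_{i,j}\in M_{s\tau_i\times s\tau_j}(\mathbb{F}),$$ built according to the following recursive construction: (1) $K_{\alpha_1,\alpha_1}$ is a block matrix of $\tau_{\alpha_1}\times\tau_{\alpha_1}$ independent blocks of $Z(C)$. (2) The blocks on the main diagonal, for $i=1,\ldots,\alpha_1-1$, are of the form $$K_{i,i}=\begin{bmatrix} K_{i+1,i+1} & Y_{i,i} \\ 0 & X_{i,i} \end{bmatrix},$$ where $X_{i,i}$ is composed of $(\tau_i-\tau_{i+1})\times(\tau_i-\tau_{i+1})$ independent blocks of $Z(C)$ and $Y_{i,i}$ is composed of $\tau_{i+1}\times(\tau_i-\tau_{i+1})$ independent blocks of $Z(C)$. (3) The blocks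 on the last column, for $i=1,\ldots,\alpha_1-1$, are of the form $$K_{i,\alpha_1}=\begin{bmatrix} Y_{i,\alpha_1} \\ X_{i,\alpha_1} \end{bmatrix},$$ where $X_{i,\alpha_1}$ is a block matrix of $(\tau_i-\tau_{i+1})\times\tau_{\alpha_1}$ independent blocks of $Z(C)$ and $$Y_{i,\alpha_1}=Y'_{i,\alpha_1}+\begin{pmatrix} \tilde{Y}_{i+1,\alpha_1} \\ \tilde{X}_{i+1,\alpha_1} \end{pmatrix},$$ where $Y'_{i,\alpha_1}$ is composed of $\tau_{i+1}\times\tau_{\alpha_1}$ independent blocks of $Z(C)$; here $Y_{\alpha_1,\alpha_1}=K_{\alpha_1,\alpha_1}$ (and $X_{\alpha_1,\alpha_1}$ is empty). (4) For $1\le i<j\le\alpha_1-1$, $$K_{i,j}=\begin{bmatrix} K_{i+1,j+1} & Y_{i,j} \\ 0 & X_{i,j} \end{bmatrix},$$ where $X_{i,j}$ is a block matrix of $(\tau_i-\tau_{i+1})\times(\tau_j-\tau_{j+1})$ independent blocks of $Z(C)$ and $$Y_{i,j}=Y'_{i,j}+\begin{pmatrix} \tilde{Y}_{i+1,j} \\ \tilde{X}_{i+1,j} \end{pmatrix},$$ where $Y'_{i,j}$ is composed of $\tau_{i+1}\times(\tau_j-\tau_{j+1})$ independent blocks of $Z(C)$.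
   Context: For a square matrix $A\in M_n(\mathbb{F})$, $Z(A)=\{B\in M_n(\mathbb{F}): AB=BA\}$ is the centralizer of $A$. Let $p=x^s+c_{s-1}x^{s-1}+\cdots+c_1x+c_0\in\mathbb{F}[x]$. Its companion matrix $C\in M_s(\mathbb{F})$ has ones on the first subdiagonal, last column $(-c_0,-c_1,\ldots,-c_{s-1})^T$, and zeros elsewhere. $E\in M_s(\mathbb{F})$ is the matrix whose only nonzero entry is a $1$ in position $(1,s)$. A generalized Segre characteristic is a sequence of integers $\alpha_1\ge\alpha_2\ge\cdots\ge\alpha_m\ge0$; its conjugate partition is $\tau=(\tau_1,\ldots,\tau_{\alpha_1})$, $\tau_i=\#\{j:\alpha_j\ge i\}$. The associated generalized Weyr matrix is the $\alpha_1\times\alpha_1$ block upper bidiagonal matrix $W$ with diagonal blocks $W_i=\mathrm{diag}(C,\ldots,C)\in M_{s\tau_i}(\mathbb{F})$ ($i=1,\ldots,\alpha_1$), superdiagonal blocks (in block position $(i,i+1)$) $E_{i+1}=\begin{bmatrix} \mathrm{diag}(E,\ldots,E) \\ 0 \end{bmatrix}\in M_{s\tau_i\times s\tau_{i+1}}(\mathbb{F})$ with $\tau_{i+1}$ copies of $E$ ($i=1,\ldots,\alpha_1-1$), and zeros elsewhere. For $X=[x_{k,l}]\in M_s(\mathbb{F})$, $\tilde{X}\in M_s(\mathbb{F})$ denotes the strictly upper triangular Toeplitz matrix with entries $\tilde{X}_{k,l}=x_{s,l-k}$ if $l>k$ and $\tilde{X}_{k,l}=0$ if $l\le k$. For a block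 matrix with $s\times s$ blocks (such as $Y_{i,j}$ or $X_{i,j}$), the tilde is applied to each $s\times s$ block separately. A "block matrix of $a\times b$ (independent) blocks" is a matrix partitioned into $a$ block rows and $b$ block columns of $s\times s$ blocks; if $a=0$ or $b=0$ it is empty. "Independent blocks of $Z(C)$" means that the $s\times s$ blocks in question (those of $K_{\alpha_1,\alpha_1}$, of the $X_{i,j}$, of the $Y_{i,i}$ with $i<\alpha_1$, and of the $Y'_{i,j}$) are elements of $Z(C)$ which are free parameters, with no relations among them: every choice of them in $Z(C)$ occurs for some $K\in Z(W)$. *)

theory Defs
  imports
    "Jordan_Normal_Form.Matrix"
    "HOL-Computational_Algebra.Polynomial"
    "HOL-Computational_Algebra.Factorial_Ring"
begin

text \<open>
  Matrices are those of \<^theory>\<open>Jordan_Normal_Form.Matrix\<close>, whose entries are indexed from \<open>0\<close>.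
  The blocks of the outer partition (the blocks \<open>W_i\<close>, \<open>K_{i,j}\<close>, ...) are indexed from \<open>1\<close>, as in
  the mathematical text; the positions of the \<open>s \<times> s\<close> blocks inside such a block start at \<open>0\<close>.
\<close>

definition centralizer :: "'a::semiring_0 mat \<Rightarrow> 'a mat set" where
  "centralizer A = {B \<in> carrier_mat (dim_row A) (dim_row A). A * B = B * A}"

definition companion :: "'a::comm_ring_1 poly \<Rightarrow> 'a mat" where
  "companion p = mat (degree p) (degree p) (\<lambda>(k, l).
     if l = degree p - 1 then - coeff p k else if k = l + 1 then 1 else 0)"

definition corner_unit :: "nat \<Rightarrow> 'a::zero_neq_one mat" where
  "corner_unit s = mat s s (\<lambda>(k, l). if k = 0 \<and> l = s - 1 then 1 else 0)"


subsection \<open>Matrices partitioned into blocks of size s times s\<close>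

definition sblock :: "nat \<Rightarrow> 'a mat \<Rightarrow> nat \<Rightarrow> nat \<Rightarrow> 'a mat" where
  "sblock s M u v = mat s s (\<lambda>(k, l). M $$ (s * u + k, s * v + l))"

definition mat_of_sblocks :: "nat \<Rightarrow> nat \<Rightarrow> nat \<Rightarrow> (nat \<Rightarrow> nat \<Rightarrow> 'a mat) \<Rightarrow> 'a mat" where
  "mat_of_sblocks s a b B =
     mat (s * a) (s * b) (\<lambda>(k, l). B (k div s) (l div s) $$ (k mod s, l mod s))"

definition sblock_mats :: "nat \<Rightarrow> nat \<Rightarrow> nat \<Rightarrow> 'a mat set \<Rightarrow> 'a mat set" where
  "sblock_mats s a b S =
     {M \<in> carrier_mat (s * a) (s * b). \<forall>u<a. \<forall>v<b. sblock s M u v \<in> S}"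

definition tilde_block :: "nat \<Rightarrow> 'a::zero mat \<Rightarrow> 'a mat" where
  "tilde_block s X = mat s s (\<lambda>(k, l). if k < l then X $$ (s - 1, l - k - 1) else 0)"

definition tilde :: "nat \<Rightarrow> 'a::zero mat \<Rightarrow> 'a mat" where
  "tilde s M = mat_of_sblocks s (dim_row M div s) (dim_col M div s)
     (\<lambda>u v. tilde_block s (sblock s M u v))"


subsection \<open>Square matrices partitioned into blocks of given sizes\<close>

text \<open>The (\<open>1\<close>-based) index of the part containing the (\<open>0\<close>-based) position \<open>k\<close>, when
  the parts have sizes \<open>r 1, r 2, ...\<close>.\<close>

definition part_index :: "(nat \<Rightarrow> nat) \<Rightarrow> nat \<Rightarrow> nat" where
  "part_index r k = (LEAST i. k < sum r {1..i})"

definition block_mat :: "nat \<Rightarrow> (nat \<Rightarrow> nat) \<Rightarrow> (nat \<Rightarrow> nat \<Rightarrow> 'a mat) \<Rightarrow> 'a mat" where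
  "block_mat n r B = mat (sum r {1..n}) (sum r {1..n}) (\<lambda>(k, l).
     let i = part_index r k; j = part_index r l
     in B i j $$ (k - sum r {1..<i}, l - sum r {1..<j}))"


subsection \<open>Generalized Segre characteristics and Weyr matrices\<close>

definition gen_segre :: "nat list \<Rightarrow> bool" where
  "gen_segre \<alpha> \<longleftrightarrow> \<alpha> \<noteq> [] \<and> sorted_wrt (\<ge>) \<alpha>"

definition conj_part :: "nat list \<Rightarrow> nat \<Rightarrow> nat" where
  "conj_part \<alpha> i = card {j. j < length \<alpha> \<and> i \<le> \<alpha> ! j}"

definition gen_weyr :: "'a::comm_ring_1 poly \<Rightarrow> nat list \<Rightarrow> 'a mat" where
  "gen_weyr p \<alpha> = (let s = degree p; \<tau> = conj_part \<alpha> in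
     block_mat (hd \<alpha>) (\<lambda>i. s * \<tau> i) (\<lambda>i j.
       if j = i then
         mat_of_sblocks s (\<tau> i) (\<tau> j) (\<lambda>u v. if u = v then companion p else 0\<^sub>m s s)
       else if j = i + 1 then
         mat_of_sblocks s (\<tau> i) (\<tau> j) (\<lambda>u v. if u = v then corner_unit s else 0\<^sub>m s s)
       else 0\<^sub>m (s * \<tau> i) (s * \<tau> j)))"


subsection \<open>The recursive construction\<close>

text \<open>
  Throughout, \<open>n\<close> is the number \<open>\<alpha>\<^sub>1\<close> of block rows and \<open>Z\<close> the set of admissible \<open>s \<times> s\<close> blocks.
  The free parameters are \<open>D = K n n\<close>, the matrices \<open>X i j\<close>, the matrices \<open>Yd i = Y i i\<close> with
  \<open>i < n\<close>, and the matrices \<open>Y' i j\<close> with \<open>i < n\<close> and \<open>i < j\<close>. The value \<open>X n n\<close> is not a parameter: it is the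
  empty matrix with \<open>s * \<tau> n\<close> columns.
\<close>

definition free_params ::
  "nat \<Rightarrow> (nat \<Rightarrow> nat) \<Rightarrow> nat \<Rightarrow> 'a::zero mat set \<Rightarrow> 'a mat \<Rightarrow> (nat \<Rightarrow> nat \<Rightarrow> 'a mat) \<Rightarrow>
   (nat \<Rightarrow> 'a mat) \<Rightarrow> (nat \<Rightarrow> nat \<Rightarrow> 'a mat) \<Rightarrow> bool" where
  "free_params s \<tau> n Z D X Yd Y' \<longleftrightarrow>
     D \<in> sblock_mats s (\<tau> n) (\<tau> n) Z \<and>
     (\<forall>i\<in>{1..<n}.
        X i i \<in> sblock_mats s (\<tau> i - \<tau> (i + 1)) (\<tau> i - \<tau> (i + 1)) Z \<and>
        Yd i \<in> sblock_mats s (\<tau> (i + 1)) (\<tau> i - \<tau> (i + 1)) Z) \<and>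
     (\<forall>i\<in>{1..<n}.
        X i n \<in> sblock_mats s (\<tau> i - \<tau> (i + 1)) (\<tau> n) Z \<and>
        Y' i n \<in> sblock_mats s (\<tau> (i + 1)) (\<tau> n) Z) \<and>
     (\<forall>i\<in>{1..<n}. \<forall>j\<in>{i + 1..<n}.
        X i j \<in> sblock_mats s (\<tau> i - \<tau> (i + 1)) (\<tau> j - \<tau> (j + 1)) Z \<and>
        Y' i j \<in> sblock_mats s (\<tau> (i + 1)) (\<tau> j - \<tau> (j + 1)) Z) \<and>
     X n n = 0\<^sub>m 0 (s * \<tau> n)"

text \<open>The blocks \<open>K i j\<close> arise from the given parameters, with auxiliary matrices \<open>Y i j\<close>.\<close>

definition built_from ::
  "nat \<Rightarrow> (nat \<Rightarrow> nat) \<Rightarrow> nat \<Rightarrow> 'a::semiring_0 mat \<Rightarrow> (nat \<Rightarrow> nat \<Rightarrow> 'a mat) \<Rightarrow>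
   (nat \<Rightarrow> 'a mat) \<Rightarrow> (nat \<Rightarrow> nat \<Rightarrow> 'a mat) \<Rightarrow>
   (nat \<Rightarrow> nat \<Rightarrow> 'a mat) \<Rightarrow> (nat \<Rightarrow> nat \<Rightarrow> 'a mat) \<Rightarrow> bool" where
  "built_from s \<tau> n D X Yd Y' Y K \<longleftrightarrow>
     (\<forall>i\<in>{1..n}. \<forall>j\<in>{1..n}. K i j \<in> carrier_mat (s * \<tau> i) (s * \<tau> j)) \<and>
     (\<forall>i\<in>{1..n}. \<forall>j\<in>{1..<i}. K i j = 0\<^sub>m (s * \<tau> i) (s * \<tau> j)) \<and>
     K n n = D \<and>
     Y n n = K n n \<and>
     (\<forall>i\<in>{1..<n}.
        Y i i = Yd i \<and>
        K i i = four_block_mat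
          (K (i + 1) (i + 1))                          (Y i i)
          (0\<^sub>m (s * (\<tau> i - \<tau> (i + 1))) (s * \<tau> (i + 1))) (X i i)) \<and>
     (\<forall>i\<in>{1..<n}.
        Y i n = Y' i n + tilde s (Y (i + 1) n @\<^sub>r X (i + 1) n) \<and>
        K i n = Y i n @\<^sub>r X i n) \<and>
     (\<forall>i\<in>{1..<n}. \<forall>j\<in>{i + 1..<n}.
        Y i j = Y' i j + tilde s (Y (i + 1) j @\<^sub>r X (i + 1) j) \<and>
        K i j = four_block_mat
          (K (i + 1) (j + 1))                          (Y i j)
          (0\<^sub>m (s * (\<tau> i - \<tau> (i + 1))) (s * \<tau> (j + 1))) (X i j))"

end

theory Submission
  imports Defs
begin

text \<open>
  Cut a matrix \<open>M\<close> of the size of \<open>W\<close> into \<open>s \<times> s\<close> blocks \<open>k i j u v\<close>: the block at position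
  \<open>(u, v)\<close> of the large block \<open>(i, j)\<close>, read as zero when a position is out of range. As \<open>W\<close> has only
  copies of \<open>C\<close> and of \<open>E\<close> as nonzero small blocks, \<open>M\<close> commutes with \<open>W\<close> iff
  \<open>C * A + E * B\<^sub>2 = A * C + B\<^sub>1 * E\<close> for every block \<open>A = k i j u v\<close> with left neighbour
  \<open>B\<^sub>1 = k i (j - 1) u v\<close> and lower neighbour \<open>B\<^sub>2 = k (i + 1) j u v\<close> (\<open>assemble_in_centralizer_iff\<close>).

  Two facts about \<open>Z(C)\<close> solve this equation. First, if \<open>Z\<close> commutes with \<open>C\<close>, then the commutator
  of \<open>C\<close> with \<open>tilde_block s Z\<close> is \<open>Z * E - E * Z\<close> (\<open>tilde_block_commutator\<close>), so that the tilde
  gives a particular solution when \<open>B\<^sub>1 = B\<^sub>2\<close>. Second, \<open>Z * E\<close> with \<open>Z\<close> in \<open>Z(C)\<close> is the commutator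
  of \<open>C\<close> with some matrix only if \<open>Z = 0\<close> (\<open>commutator_eq_mult_E_imp_zero\<close>): a
  commutator with \<open>C\<close> has trace zero even after multiplication by an element of \<open>Z(C)\<close>, while the form \<open>mat_trace (Y * Z * E)\<close> in \<open>Y\<close> and \<open>Z\<close>
  is nondegenerate on \<open>Z(C)\<close>. This forces \<open>B\<^sub>1 = B\<^sub>2\<close>. Both survive the addition of a common term
  \<open>tilde_block s Y\<close> to \<open>B\<^sub>1\<close> and \<open>B\<^sub>2\<close>, because tilde matrices are annihilated by \<open>E\<close> on
  both sides and have zero tilde (\<open>commutator_solutions\<close>). Induction along the block diagonals,
  from the lower left corner to the upper right one, now shows that \<open>M\<close> commutes with \<open>W\<close> iff

  \<^item> \<open>k i (j - 1) u v = k (i + 1) j u v\<close> for \<open>v < \<tau> j\<close>, and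
  \<^item> \<open>k i j u v - tilde_block s (k (i + 1) j u v)\<close> lies in \<open>Z(C)\<close>

  (\<open>assemble_in_centralizer_iff_linked\<close>). The first condition says that the large blocks below the
  diagonal vanish and that \<open>k i j\<close> contains \<open>k (i + 1) (j + 1)\<close> as its upper left part, with zeros
  below it; what remains free are the columns of \<open>k i j\<close> with \<open>\<tau> (j + 1) \<le> v\<close>. By
  the second condition these consist of an arbitrary element of \<open>Z(C)\<close> plus a tilde of the block one
  row further down. This is the recursive construction: reading the free elements off
  the blocks gives the parameters (\<open>params_of_blocks\<close>), and running the recursion on
  arbitrary parameters gives a matrix of the centralizer (\<open>block_recursion\<close>).
\<close>

section \<open>The centralizer of a companion matrix\<close>

locale companion_blocks =
  fixes p :: "'a::comm_ring_1 poly" and s :: nat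
  assumes degree_p: "degree p = s" and s_pos: "0 < s"
begin

abbreviation C where "C \<equiv> companion p"
abbreviation E where "E \<equiv> corner_unit s :: 'a mat"

lemma C_carrier [simp]: "C \<in> carrier_mat s s"
  by (simp add: companion_def degree_p)

lemma E_carrier [simp]: "E \<in> carrier_mat s s"
  by (simp add: corner_unit_def)

lemma C_dim [simp]: "dim_row C = s" "dim_col C = s"
  by (simp_all add: companion_def degree_p)

lemma E_dim [simp]: "dim_row E = s" "dim_col E = s"
  by (simp_all add: corner_unit_def)

lemma tilde_block_carrier [simp]: "tilde_block s X \<in> carrier_mat s s"
  by (simp add: tilde_block_def)

lemma tilde_block_dim [simp]: "dim_row (tilde_block s X) = s" "dim_col (tilde_block s X) = s"
  by (simp_all add: tilde_block_def)

lemma square_closed [simp]: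
  fixes A B :: "'a mat"
  assumes "A \<in> carrier_mat s s" "B \<in> carrier_mat s s"
  shows "A * B \<in> carrier_mat s s" "A + B \<in> carrier_mat s s" "A - B \<in> carrier_mat s s"
  using assms by auto

lemma centralizer_C_iff: "Z \<in> centralizer C \<longleftrightarrow> Z \<in> carrier_mat s s \<and> C * Z = Z * C"
  by (simp add: centralizer_def)

lemma C_mult_index:
  assumes A: "A \<in> carrier_mat s s" and k: "k < s" and l: "l < s"
  shows "(C * A) $$ (k, l) = (if k = 0 then 0 else A $$ (k - 1, l)) - coeff p k * A $$ (s - 1, l)"
proof -
  have "(C * A) $$ (k, l) = (\<Sum>m\<in>{0..<s}. C $$ (k, m) * A $$ (m, l))"
    using A k l by (simp add: scalar_prod_def)
  also have "\<dots> = (\<Sum>m\<in>{0..<s}. (if m = s - 1 then - coeff p k * A $$ (m, l) else 0)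
      + (if m = k - 1 then (if k = 0 then 0 else A $$ (k - 1, l)) else 0))"
    using k s_pos by (intro sum.cong refl) (auto simp: companion_def degree_p)
  also have "\<dots> = (if k = 0 then 0 else A $$ (k - 1, l)) - coeff p k * A $$ (s - 1, l)"
    using k s_pos by (simp add: sum.distrib less_imp_diff_less)
  finally show ?thesis .
qed

lemma mult_C_index:
  assumes A: "A \<in> carrier_mat s s" and k: "k < s" and l: "l < s"
  shows "(A * C) $$ (k, l) =
    (if l = s - 1 then - (\<Sum>m<s. A $$ (k, m) * coeff p m) else A $$ (k, l + 1))"
proof -
  have *: "(A * C) $$ (k, l) = (\<Sum>m\<in>{0..<s}. A $$ (k, m) * C $$ (m, l))"
    using A k l by (simp add: scalar_prod_def)
  show ?thesis
  proof (cases "l = s - 1")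
    case True
    then show ?thesis
      using l unfolding * by (simp add: companion_def degree_p sum_negf lessThan_atLeast0)
  next
    case False
    have "(\<Sum>m\<in>{0..<s}. A $$ (k, m) * C $$ (m, l)) = (\<Sum>m\<in>{0..<s}. if m = l + 1 then A $$ (k, m) else 0)"
      using l False by (intro sum.cong refl) (auto simp: companion_def degree_p)
    then show ?thesis
      using l False unfolding * by (simp add: less_diff_conv)
  qed
qed

lemma E_mult_index:
  assumes A: "A \<in> carrier_mat s s" and k: "k < s" and l: "l < s"
  shows "(E * A) $$ (k, l) = (if k = 0 then A $$ (s - 1, l) else 0)"
proof -
  have "(E * A) $$ (k, l) = (\<Sum>m\<in>{0..<s}. E $$ (k, m) * A $$ (m, l))"
    using A k l by (simp add: scalar_prod_def)
  also have "\<dots> = (\<Sum>m\<in>{0..<s}. if m = s - 1 then (if k = 0 then A $$ (s - 1, l) else 0) else 0)"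
    using k by (intro sum.cong refl) (auto simp: corner_unit_def)
  finally show ?thesis using s_pos by simp
qed

lemma mult_E_index:
  assumes A: "A \<in> carrier_mat s s" and k: "k < s" and l: "l < s"
  shows "(A * E) $$ (k, l) = (if l = s - 1 then A $$ (k, 0) else 0)"
proof -
  have "(A * E) $$ (k, l) = (\<Sum>m\<in>{0..<s}. A $$ (k, m) * E $$ (m, l))"
    using A k l by (simp add: scalar_prod_def)
  also have "\<dots> = (\<Sum>m\<in>{0..<s}. if m = 0 then (if l = s - 1 then A $$ (k, 0) else 0) else 0)"
    using l by (intro sum.cong refl) (auto simp: corner_unit_def)
  finally show ?thesis using s_pos by simp
qed

text \<open>
  Comparing the entries of \<open>C * Z\<close> and \<open>Z * C\<close> outside the last column: each entry is determined
  by its neighbour to the upper left and the last row.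
\<close>

lemma centralizer_C_entry:
  assumes Z: "Z \<in> centralizer C" and k: "k < s" and l: "l + 1 < s"
  shows "Z $$ (k, l + 1) = (if k = 0 then 0 else Z $$ (k - 1, l)) - coeff p k * Z $$ (s - 1, l)"
proof -
  have "Z \<in> carrier_mat s s" "(C * Z) $$ (k, l) = (Z * C) $$ (k, l)"
    using Z by (simp_all add: centralizer_C_iff)
  then show ?thesis
    using k l by (auto simp: C_mult_index mult_C_index simp del: index_mult_mat)
qed

text \<open>
  Iterating \<open>centralizer_C_entry\<close> down a diagonal. At \<open>d = s - 1 - k\<close> it expresses the first column, which
  \<open>Z * E\<close> moves to the last place, by the last row, from which the tilde is made.
\<close>

lemma centralizer_C_first_col:
  assumes Z: "Z \<in> centralizer C" and "k + d < s"
  shows "Z $$ (k, 0) = Z $$ (k + d, d) + (\<Sum>m\<in>{k+1..k+d}. coeff p m * Z $$ (s - 1, m - k - 1))"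
  using assms(2)
proof (induction d)
  case (Suc d)
  then show ?case
    using centralizer_C_entry[OF Z, of "k + Suc d" d] by simp
qed simp

text \<open>
  Outside the last column, \<open>C\<close> shifts rows on the left and columns on the right, and both shifts agree
  on a Toeplitz matrix except in the first row, where the last row of \<open>Z\<close> appears: this is
  \<open>- E * Z\<close>. The last column also involves the coefficients of \<open>p\<close>, and there
  \<open>centralizer_C_first_col\<close> identifies the outcome as the first column of \<open>Z\<close>.
\<close>

lemma tilde_block_commutator:
  assumes Z: "Z \<in> centralizer C"
  shows "C * tilde_block s Z - tilde_block s Z * C = Z * E - E * Z"
proof (rule eq_matI)
  let ?T = "tilde_block s Z"
  have Zc: "Z \<in> carrier_mat s s"
    using Z by (simp add: centralizer_C_iff)
  fix k l
  assume "k < dim_row (Z * E - E * Z)" "l < dim_col (Z * E - E * Z)"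
  then have k: "k < s" and l: "l < s" using Zc by simp_all
  have CT: "(C * ?T) $$ (k, l) = (if k = 0 then 0 else ?T $$ (k - 1, l))"
    using k l by (simp add: C_mult_index del: index_mult_mat) (simp add: tilde_block_def)
  have T: "?T $$ (a, b) = (if a < b then Z $$ (s - 1, b - a - 1) else 0)" if "a < s" "b < s" for a b
    using that by (simp add: tilde_block_def)
  have "(C * ?T) $$ (k, l) - (?T * C) $$ (k, l) = (Z * E) $$ (k, l) - (E * Z) $$ (k, l)"
  proof (cases "l = s - 1")
    case True
    have "(\<Sum>m<s. ?T $$ (k, m) * coeff p m) = (\<Sum>m\<in>{k+1..k+(s-1-k)}. coeff p m * Z $$ (s - 1, m - k - 1))"
      using k by (intro sum.mono_neutral_cong_right) (auto simp: T)
    also have "\<dots> = Z $$ (k, 0) - Z $$ (s - 1, s - 1 - k)"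
      using centralizer_C_first_col[OF Z, of k "s - 1 - k"] k by simp
    finally show ?thesis
      using k l Zc unfolding CT
      by (auto simp add: True mult_C_index mult_E_index E_mult_index T simp del: index_mult_mat)
  next
    case False
    then show ?thesis
      using k l Zc by (auto simp: CT mult_C_index mult_E_index E_mult_index T simp del: index_mult_mat) 
  qed
  then show "(C * ?T - ?T * C) $$ (k, l) = (Z * E - E * Z) $$ (k, l)"
    using k l Zc by simp
qed (use Z in \<open>auto simp: centralizer_C_iff\<close>)

definition mat_trace :: "'a mat \<Rightarrow> 'a" where
  "mat_trace M = (\<Sum>k<s. M $$ (k, k))"

lemma mat_trace_mult_commute:
  assumes "A \<in> carrier_mat s s" "B \<in> carrier_mat s s"
  shows "mat_trace (A * B) = mat_trace (B * A)"
proof -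
  have "mat_trace (A * B) = (\<Sum>k<s. \<Sum>m<s. A $$ (k, m) * B $$ (m, k))"
    using assms by (simp add: mat_trace_def scalar_prod_def lessThan_atLeast0)
  also have "\<dots> = (\<Sum>m<s. \<Sum>k<s. B $$ (m, k) * A $$ (k, m))"
    by (subst sum.swap) (simp add: mult.commute)
  also have "\<dots> = mat_trace (B * A)"
    using assms by (simp add: mat_trace_def scalar_prod_def lessThan_atLeast0)
  finally show ?thesis .
qed

lemma mat_trace_minus:
  assumes "A \<in> carrier_mat s s" "B \<in> carrier_mat s s"
  shows "mat_trace (A - B) = mat_trace A - mat_trace B"
  using assms by (simp add: mat_trace_def sum_subtractf)

lemma mat_trace_mult_E:
  assumes "A \<in> carrier_mat s s"
  shows "mat_trace (A * E) = A $$ (s - 1, 0)"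
proof -
  have "mat_trace (A * E) = (\<Sum>k<s. if k = s - 1 then A $$ (s - 1, 0) else 0)"
    unfolding mat_trace_def using assms
    by (intro sum.cong refl) (simp add: mult_E_index del: index_mult_mat)
  then show ?thesis using s_pos by simp
qed

lemma centralizer_C_mult:
  assumes "Y \<in> centralizer C" "Z \<in> centralizer C"
  shows "Y * Z \<in> centralizer C"
proof -
  have [simp]: "Y \<in> carrier_mat s s" "Z \<in> carrier_mat s s"
    and c: "C * Y = Y * C" "C * Z = Z * C"
    using assms by (simp_all add: centralizer_C_iff)
  have "C * (Y * Z) = Y * C * Z"
    using c(1) assoc_mult_mat[of C s s Y s Z s] by simp
  also have "\<dots> = Y * Z * C"
    using c(2) by (simp add: assoc_mult_mat[of Y s s _ s _ s])
  finally show ?thesis by (simp add: centralizer_C_iff)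
qed

lemma centralizer_C_diff:
  assumes "Y \<in> centralizer C" "Z \<in> centralizer C"
  shows "Y - Z \<in> centralizer C"
  using assms by (simp add: centralizer_C_iff mult_minus_distrib_mat[of _ s s _ s]
      minus_mult_distrib_mat[of _ s s _ _ s])

lemma zero_in_centralizer_C [simp]: "0\<^sub>m s s \<in> centralizer C"
  by (simp add: centralizer_C_iff)

lemma C_in_centralizer_C [simp]: "C \<in> centralizer C"
  by (simp add: centralizer_C_iff)

text \<open>
  The trace is the lower left entry of \<open>Y * Z\<close>. Multiplication of \<open>Z\<close> by \<open>C\<close> moves the next higher
  entry of the first column into the last row, as long as the entries below it vanish. So testing with
  the powers of \<open>C\<close> kills the first column from the bottom to the top, and the first column determines
  an element of \<open>Z(C)\<close>.
\<close>

lemma centralizer_C_form_nondegenerate: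
  assumes Z: "Z \<in> centralizer C"
    and orth: "\<And>Y. Y \<in> centralizer C \<Longrightarrow> mat_trace (Y * Z * E) = 0"
  shows "Z = 0\<^sub>m s s"
proof -
  have lower: "Z $$ (s - 1 - j, 0) = 0"
    if "Z \<in> centralizer C" "\<And>Y. Y \<in> centralizer C \<Longrightarrow> mat_trace (Y * Z * E) = 0" "j < s" for j Z
    using that
  proof (induction j arbitrary: Z)
    case 0
    then have Zc: "Z \<in> carrier_mat s s" by (simp add: centralizer_C_iff)
    have "1\<^sub>m s \<in> centralizer C" by (simp add: centralizer_C_iff)
    from 0(2)[OF this] show ?case using Zc by (simp add: mat_trace_mult_E)
  next
    case (Suc j)
    then have Zc: "Z \<in> carrier_mat s s" by (simp add: centralizer_C_iff)
    have "1\<^sub>m s \<in> centralizer C" by (simp add: centralizer_C_iff)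
    from Suc(3)[OF this] have last: "Z $$ (s - 1, 0) = 0" using Zc by (simp add: mat_trace_mult_E)
    have "(C * Z) $$ (s - 1 - j, 0) = 0"
    proof (rule Suc.IH)
      show "C * Z \<in> centralizer C" using Suc(2) by (simp add: centralizer_C_mult)
      show "mat_trace (Y * (C * Z) * E) = 0" if "Y \<in> centralizer C" for Y
      proof -
        have "Y * (C * Z) = Y * C * Z"
          using that Zc by (simp add: centralizer_C_iff assoc_mult_mat[of Y s s C s Z s])
        then show ?thesis using Suc(3)[of "Y * C"] that by (simp add: centralizer_C_mult)
      qed
    qed (use Suc(4) in simp)
    moreover have "(C * Z) $$ (s - 1 - j, 0) = Z $$ (s - 1 - Suc j, 0)"
      using Zc Suc(4) last by (simp add: C_mult_index del: index_mult_mat)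
    ultimately show ?case by simp
  qed
  have "Z $$ (k, l) = 0" if "k < s" "l < s" for k l
    using that
  proof (induction l arbitrary: k)
    case 0
    then show ?case using lower[OF Z orth, of "s - 1 - k"] by simp
  next
    case (Suc l)
    then show ?case using centralizer_C_entry[OF Z, of k l] by simp
  qed
  then show ?thesis using Z by (intro eq_matI) (auto simp: centralizer_C_iff)
qed

text \<open>
  A commutator with \<open>C\<close>, multiplied by an element of \<open>Z(C)\<close>, has trace zero. So \<open>Z\<close> lies in the
  radical of the form above.
\<close>

lemma commutator_eq_mult_E_imp_zero:
  assumes A: "A \<in> carrier_mat s s" and Z: "Z \<in> centralizer C"
    and eq: "C * A - A * C = Z * E"
  shows "Z = 0\<^sub>m s s"
proof (rule centralizer_C_form_nondegenerate[OF Z])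
  fix X assume X: "X \<in> centralizer C"
  then have [simp]: "X \<in> carrier_mat s s" and XC: "C * X = X * C"
    by (simp_all add: centralizer_C_iff)
  have [simp]: "Z \<in> carrier_mat s s" "A \<in> carrier_mat s s"
    using A Z by (simp_all add: centralizer_C_iff)
  have "X * (C * A) = X * C * A" by (rule assoc_mult_mat[of _ s s _ s _ s, symmetric]) simp_all
  also have "\<dots> = C * (X * A)" unfolding XC[symmetric] by (rule assoc_mult_mat[of _ s s _ s _ s]) simp_all
  finally have "mat_trace (X * (C * A)) = mat_trace (C * (X * A))" by simp
  also have "\<dots> = mat_trace (X * A * C)" by (rule mat_trace_mult_commute) simp_all
  also have "X * A * C = X * (A * C)" by (rule assoc_mult_mat[of _ s s _ s _ s]) simp_all
  finally have "mat_trace (X * (C * A - A * C)) = 0"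
    by (simp add: mult_minus_distrib_mat[of X s s _ s] mat_trace_minus)
  also have "X * (C * A - A * C) = X * Z * E"
    unfolding eq by (rule assoc_mult_mat[of _ s s _ s _ s, symmetric]) simp_all
  finally show "mat_trace (X * Z * E) = 0" .
qed

lemma tilde_block_add_tilde_block:
  fixes Z :: "'a mat"
  assumes "Z \<in> carrier_mat s s"
  shows "tilde_block s (Z + tilde_block s Y) = tilde_block s Z"
  using assms by (intro eq_matI) (auto simp: tilde_block_def)

lemma tilde_block_mult_E: "tilde_block s Y * E = 0\<^sub>m s s"
  by (intro eq_matI) (auto simp: mult_E_index tilde_block_def simp del: index_mult_mat(1))

lemma E_mult_tilde_block: "E * tilde_block s Y = 0\<^sub>m s s"
  by (intro eq_matI) (auto simp: E_mult_index tilde_block_def simp del: index_mult_mat(1))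

lemma tilde_block_commutator':
  assumes Z: "Z \<in> centralizer C" and B: "B = Z + tilde_block s Y"
  shows "C * tilde_block s B - tilde_block s B * C = B * E - E * B"
proof -
  have [simp]: "Z \<in> carrier_mat s s" using Z by (simp add: centralizer_C_iff)
  have "Z * E + 0\<^sub>m s s = Z * E" "E * Z + 0\<^sub>m s s = E * Z"
    by (rule right_add_zero_mat, simp)+
  then have "B * E = Z * E" "E * B = E * Z"
    by (simp_all add: B add_mult_distrib_mat[of _ s s _ _ s] mult_add_distrib_mat[of _ s s _ s]
        tilde_block_mult_E E_mult_tilde_block)
  moreover have "tilde_block s B = tilde_block s Z"
    by (simp add: B tilde_block_add_tilde_block)
  ultimately show ?thesis
    using tilde_block_commutator[OF Z] by simp
qed

text \<open>
  The commutation equation for a single block, with neighbours that differ from elements of \<open>Z(C)\<close>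
  by the same tilde matrix. Subtracting \<open>tilde_block s B2\<close> from \<open>A\<close> turns it into a commutator equal to
  \<open>(Z1 - Z2) * E\<close>, so that \<open>Z1 = Z2\<close> and nothing is left on the right-hand side.
\<close>

lemma commutator_solutions:
  assumes A: "A \<in> carrier_mat s s"
    and Z: "Z1 \<in> centralizer C" "Z2 \<in> centralizer C"
    and B: "B1 = Z1 + tilde_block s Y" "B2 = Z2 + tilde_block s Y"
    and eq: "C * A + E * B2 = A * C + B1 * E"
  shows "B1 = B2" "A - tilde_block s B2 \<in> centralizer C"
proof -
  have [simp]: "Z1 \<in> carrier_mat s s" "Z2 \<in> carrier_mat s s" "A \<in> carrier_mat s s"
    using A Z by (simp_all add: centralizer_C_iff)
  let ?A = "A - tilde_block s B2"
  have Bc [simp]: "B1 \<in> carrier_mat s s" "B2 \<in> carrier_mat s s" by (simp_all add: B)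
  have Bd [simp]: "dim_row B1 = s" "dim_col B1 = s" "dim_row B2 = s" "dim_col B2 = s"
    using Bc by blast+
  have Ad [simp]: "dim_row A = s" "dim_col A = s" using A by blast+
  have Zd [simp]: "dim_row Z1 = s" "dim_col Z1 = s" "dim_row Z2 = s" "dim_col Z2 = s"
    using \<open>Z1 \<in> carrier_mat s s\<close> \<open>Z2 \<in> carrier_mat s s\<close> by blast+
  have "C * ?A - ?A * C = (C * A - C * tilde_block s B2) - (A * C - tilde_block s B2 * C)"
    by (simp add: mult_minus_distrib_mat[of _ s s _ s] minus_mult_distrib_mat[of _ s s _ _ s])
  also have "\<dots> = Z1 * E - Z2 * E"
  proof (rule eq_matI)
    fix k l
    assume "k < dim_row (Z1 * E - Z2 * E)" "l < dim_col (Z1 * E - Z2 * E)"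
    then have kl: "k < s" "l < s" by simp_all
    have "Z1 * E + 0\<^sub>m s s = Z1 * E" "Z2 * E + 0\<^sub>m s s = Z2 * E"
      by (rule right_add_zero_mat, simp)+
    then have "B1 * E = Z1 * E" "B2 * E = Z2 * E"
      by (simp_all add: B add_mult_distrib_mat[of _ s s _ _ s] tilde_block_mult_E)
    moreover note arg_cong[OF eq, of "\<lambda>M. M $$ (k, l)"]
      arg_cong[OF tilde_block_commutator'[OF Z(2) B(2)], of "\<lambda>M. M $$ (k, l)"]
    ultimately have "(Z1 * E) $$ (k, l) = (C * A) $$ (k, l) + (E * B2) $$ (k, l) - (A * C) $$ (k, l)"
      and "(Z2 * E) $$ (k, l) = (C * tilde_block s B2) $$ (k, l)
        - (tilde_block s B2 * C) $$ (k, l) + (E * B2) $$ (k, l)"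
      using kl by (simp_all add: algebra_simps del: index_mult_mat(1))
    note entries = this
    have "(Z1 * E - Z2 * E) $$ (k, l) = (Z1 * E) $$ (k, l) - (Z2 * E) $$ (k, l)"
      using kl by simp
    also have "\<dots> = (C * A) $$ (k, l) - (C * tilde_block s B2) $$ (k, l)
        - ((A * C) $$ (k, l) - (tilde_block s B2 * C) $$ (k, l))"
      unfolding entries by (simp add: algebra_simps del: index_mult_mat(1))
    finally show "(C * A - C * tilde_block s B2 - (A * C - tilde_block s B2 * C)) $$ (k, l) =
        (Z1 * E - Z2 * E) $$ (k, l)"
      using kl by (simp del: index_mult_mat(1))
  qed simp_all
  also have "\<dots> = (Z1 - Z2) * E"
    by (simp add: minus_mult_distrib_mat[of _ s s _ _ s])
  finally have comm: "C * ?A - ?A * C = (Z1 - Z2) * E" .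
  have diff: "Z1 - Z2 = 0\<^sub>m s s"
    by (rule commutator_eq_mult_E_imp_zero[OF _ centralizer_C_diff[OF Z] comm]) simp
  then have Zeq: "Z1 = Z2"
    by (auto simp: mat_eq_iff)
  then show "B1 = B2" by (simp add: B)
  have "C * ?A - ?A * C = 0\<^sub>m s s"
    using comm left_mult_zero_mat[OF E_carrier] unfolding diff by simp
  then show "?A \<in> centralizer C"
    by (auto simp: centralizer_C_iff mat_eq_iff)
qed

end


section \<open>Positions in partitioned matrices\<close>

lemma sum_lessThan_split:
  fixes f :: "nat \<Rightarrow> 'b::comm_monoid_add"
  shows "sum f {..<a + b} = sum f {..<a} + (\<Sum>x<b. f (a + x))"
  by (induction b) (simp_all add: add.assoc)

lemma sum_if_const:
  fixes f :: "'b \<Rightarrow> 'c::comm_monoid_add"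
  shows "(\<Sum>x\<in>A. if P then f x else 0) = (if P then sum f A else 0)"
  by simp

lemma sum_over_parts:
  fixes f :: "nat \<Rightarrow> 'b::comm_monoid_add" and n :: nat
  shows "sum f {..<sum r {1..n}} = (\<Sum>i\<in>{1..n}. \<Sum>x<r i. f (sum r {1..<i} + x))"
  by (induction n) (simp_all add: sum_lessThan_split atLeastLessThanSuc_atLeastAtMost)

lemma sum_over_sblocks:
  fixes f :: "nat \<Rightarrow> 'b::comm_monoid_add"
  shows "sum f {..<s * t} = (\<Sum>u<t. \<Sum>a<s. f (s * u + a))"
proof (induction t)
  case (Suc t)
  have "sum f {..<s * Suc t} = sum f {..<s * t + s}" by (simp add: add.commute)
  with Suc show ?case by (simp add: sum_lessThan_split)
qed simp

lemma part_index_offset: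
  assumes "1 \<le> i" "x < r i"
  shows "part_index r (sum r {1..<i} + x) = i"
  unfolding part_index_def
proof (rule Least_equality)
  have "sum r {1..i} = sum r {1..<i} + r i"
    using assms(1) by (metis add.commute sum.last_plus)
  then show "sum r {1..<i} + x < sum r {1..i}" using assms(2) by simp
  fix y assume y: "sum r {1..<i} + x < sum r {1..y}"
  show "i \<le> y"
  proof (rule ccontr)
    assume "\<not> i \<le> y"
    then have "sum r {1..y} \<le> sum r {1..<i}" by (intro sum_mono2) auto
    with y show False by simp
  qed
qed

lemma part_position_less:
  fixes r :: "nat \<Rightarrow> nat"
  assumes "i \<in> {1..n}" "x < r i"
  shows "sum r {1..<i} + x < sum r {1..n}"
proof -
  have "sum r {1..<i} + x < sum r {1..<i} + r i" using assms by simp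
  also have "\<dots> = sum r {1..i}" using assms(1) by (metis add.commute atLeastAtMost_iff sum.last_plus)
  also have "\<dots> \<le> sum r {1..n}" using assms by (intro sum_mono2) auto
  finally show ?thesis .
qed

lemma part_position_cases:
  fixes r :: "nat \<Rightarrow> nat"
  assumes "k < sum r {1..n}"
  obtains i x where "i \<in> {1..n}" "x < r i" "k = sum r {1..<i} + x"
  using assms
proof (induction n arbitrary: thesis)
  case (Suc n)
  show ?case
  proof (cases "k < sum r {1..n}")
    case True
    then obtain i x where "i \<in> {1..n}" "x < r i" "k = sum r {1..<i} + x" using Suc.IH by blast
    then show ?thesis using Suc.prems(1)[of i x] by simp
  next
    case False
    then show ?thesis
      using Suc.prems(2) Suc.prems(1)[of "Suc n" "k - sum r {1..n}"]
      by (simp add: atLeastLessThanSuc_atLeastAtMost)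
  qed
qed simp

lemma block_mat_dim [simp]:
  "dim_row (block_mat n r B) = sum r {1..n}" "dim_col (block_mat n r B) = sum r {1..n}"
  by (simp_all add: block_mat_def)

lemma block_mat_index:
  assumes "i \<in> {1..n}" "x < r i" "j \<in> {1..n}" "y < r j"
  shows "block_mat n r B $$ (sum r {1..<i} + x, sum r {1..<j} + y) = B i j $$ (x, y)"
  using assms part_position_less[of i n x r] part_position_less[of j n y r]
    part_index_offset[of i x r] part_index_offset[of j y r]
  by (simp add: block_mat_def Let_def)

lemma sblock_position_cases:
  assumes "(x::nat) < s * t"
  obtains u a where "u < t" "a < s" "x = s * u + a"
proof
  show "x div s < t" using assms by (metis less_mult_imp_div_less mult.commute)
  show "x mod s < s" using assms by (cases "s = 0") auto
qed simp

lemma sblock_position_less: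
  assumes "u < t" "a < (s::nat)"
  shows "s * u + a < s * t"
proof -
  have "s * u + a < s * Suc u" using assms by simp
  also have "\<dots> \<le> s * t" using assms by (intro mult_le_mono2) simp
  finally show ?thesis .
qed

lemma mat_of_sblocks_dim [simp]:
  "dim_row (mat_of_sblocks s a b B) = s * a" "dim_col (mat_of_sblocks s a b B) = s * b"
  by (simp_all add: mat_of_sblocks_def)

lemma mat_of_sblocks_index [simp]:
  assumes "u < m" "v < l" "a < s" "b < s"
  shows "mat_of_sblocks s m l B $$ (s * u + a, s * v + b) = B u v $$ (a, b)"
  using assms sblock_position_less[of u m a s] sblock_position_less[of v l b s]
  by (simp add: mat_of_sblocks_def)

lemma mat_eq_by_sblocks:
  assumes A: "A \<in> carrier_mat (s * m) (s * l)" and B: "B \<in> carrier_mat (s * m) (s * l)"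
    and eq: "\<And>u v. u < m \<Longrightarrow> v < l \<Longrightarrow> sblock s A u v = sblock s B u v"
  shows "A = B"
proof (rule eq_matI)
  fix x y assume "x < dim_row B" "y < dim_col B"
  then obtain u a v b where *: "u < m" "a < s" "x = s * u + a" "v < l" "b < s" "y = s * v + b"
    using B by (auto elim!: sblock_position_cases[of x s m] sblock_position_cases[of y s l])
  then have "sblock s A u v $$ (a, b) = sblock s B u v $$ (a, b)" using eq by simp
  then show "A $$ (x, y) = B $$ (x, y)" using * by (simp add: sblock_def)
qed (use A B in auto)

lemma sblock_carrier [simp]: "sblock s A u v \<in> carrier_mat s s"
  by (simp add: sblock_def)

lemma sblock_dim [simp]: "dim_row (sblock s A u v) = s" "dim_col (sblock s A u v) = s"
  by (simp_all add: sblock_def)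

lemma sblock_mat_of_sblocks:
  assumes "u < m" "v < l" "B u v \<in> carrier_mat s s"
  shows "sblock s (mat_of_sblocks s m l B) u v = B u v"
  using assms by (intro eq_matI) (auto simp: sblock_def)

lemma mat_of_sblocks_carrier [simp]: "mat_of_sblocks s m l B \<in> carrier_mat (s * m) (s * l)"
  by (simp add: carrier_matI)

lemma sblock_zero:
  assumes "u < m" "v < l"
  shows "sblock s (0\<^sub>m (s * m) (s * l)) u v = 0\<^sub>m s s"
  using assms by (intro eq_matI) (auto simp: sblock_def sblock_position_less)

lemma sblock_add:
  assumes "B \<in> carrier_mat (s * m) (s * l)" "u < m" "v < l"
  shows "sblock s (A + B) u v = sblock s A u v + sblock s B u v"
  using assms by (intro eq_matI) (auto simp: sblock_def sblock_position_less)

lemma sblock_tilde: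
  assumes A: "A \<in> carrier_mat (s * m) (s * l)" "u < m" "v < l" and "0 < s"
  shows "sblock s (tilde s A) u v = tilde_block s (sblock s A u v)"
  using assms unfolding tilde_def by (subst sblock_mat_of_sblocks) (auto simp: tilde_block_def)

lemma tilde_carrier:
  assumes "A \<in> carrier_mat (s * m) (s * l)" "0 < s"
  shows "tilde s A \<in> carrier_mat (s * m) (s * l)"
  using assms by (auto simp: tilde_def)

lemma sblock_four_block_mat:
  assumes A: "A \<in> carrier_mat (s * m1) (s * l1)" and D: "D \<in> carrier_mat (s * m2) (s * l2)"
    and u: "u < m1 + m2" and v: "v < l1 + l2"
  shows "sblock s (four_block_mat A B C D) u v =
    (if u < m1 then if v < l1 then sblock s A u v else sblock s B u (v - l1)
     else if v < l1 then sblock s C (u - m1) v else sblock s D (u - m1) (v - l1))"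
proof (rule eq_matI)
  let ?R = "if u < m1 then if v < l1 then sblock s A u v else sblock s B u (v - l1)
     else if v < l1 then sblock s C (u - m1) v else sblock s D (u - m1) (v - l1)"
  fix a b assume "a < dim_row ?R" "b < dim_col ?R"
  then have ab: "a < s" "b < s" by (simp_all split: if_splits)
  have shift: "s * x + a < s * m \<longleftrightarrow> x < m" "\<not> x < m \<Longrightarrow> s * x + a - s * m = s * (x - m) + a"
    if "a < s" for x m a
  proof -
    show "s * x + a < s * m \<longleftrightarrow> x < m"
    proof
      assume *: "s * x + a < s * m"
      show "x < m"
      proof (rule ccontr)
        assume "\<not> x < m"
        then have "s * m \<le> s * x" by simp
        with * show False by simp
      qed
    qed (rule sblock_position_less[OF _ that])
    assume "\<not> x < m"
    then obtain d where "x = m + d" by (metis le_iff_add not_less)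
    then show "s * x + a - s * m = s * (x - m) + a" by (simp add: distrib_left)
  qed
  have "s * u + a < s * m1 + s * m2" "s * v + b < s * l1 + s * l2"
    using sblock_position_less[OF u ab(1)] sblock_position_less[OF v ab(2)] by (simp_all add: distrib_left)
  then show "sblock s (four_block_mat A B C D) u v $$ (a, b) = ?R $$ (a, b)"
    using A D ab by (auto simp add: sblock_def shift)
qed (simp_all add: sblock_def)

lemma sblock_append_rows:
  assumes A: "A \<in> carrier_mat (s * m1) (s * l)" and B: "B \<in> carrier_mat (s * m2) (s * l)"
    and u: "u < m1 + m2" and v: "v < l"
  shows "sblock s (A @\<^sub>r B) u v = (if u < m1 then sblock s A u v else sblock s B (u - m1) v)"
  unfolding append_rows_def
  using A B u v by (subst sblock_four_block_mat[of _ s m1 l _ m2 0]) auto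

lemma append_rows_carrier_sblocks:
  assumes "A \<in> carrier_mat (s * m1) c" "B \<in> carrier_mat (s * m2) c" "m1 + m2 = m"
  shows "A @\<^sub>r B \<in> carrier_mat (s * m) c"
  using carrier_append_rows[OF assms(1,2)] assms(3) by (metis distrib_left)

lemma four_block_carrier_sblocks:
  assumes "A \<in> carrier_mat (s * m1) (s * l1)" "D \<in> carrier_mat (s * m2) (s * l2)"
    "m1 + m2 = m" "l1 + l2 = l"
  shows "four_block_mat A B C D \<in> carrier_mat (s * m) (s * l)"
  using four_block_carrier_mat[OF assms(1,2)] assms(3,4) by (metis distrib_left)


section \<open>The commutation equations of the Weyr matrix in terms of small blocks\<close>

text \<open>
  The shape of the Weyr matrix depends on the characteristic only through a nonincreasing sequence \<open>\<tau>\<close>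
  that vanishes beyond \<open>n\<close>. The vanishing makes the last block column an instance of the general
  one: its blocks have \<open>\<tau> (n + 1) = 0\<close> columns to share with the next diagonal neighbour.
\<close>

locale weyr_blocks = companion_blocks +
  fixes \<tau> :: "nat \<Rightarrow> nat" and n :: nat
  assumes \<tau>_Suc_le: "\<tau> (Suc i) \<le> \<tau> i" and \<tau>_zero: "n < i \<Longrightarrow> \<tau> i = 0"
begin

definition pos :: "nat \<Rightarrow> nat \<Rightarrow> nat \<Rightarrow> nat" where
  "pos i u a = (\<Sum>i'\<in>{1..<i}. s * \<tau> i') + (s * u + a)"

definition N :: nat where "N = (\<Sum>i\<in>{1..n}. s * \<tau> i)"

definition inside :: "nat \<Rightarrow> nat \<Rightarrow> nat \<Rightarrow> bool" where
  "inside i u a \<longleftrightarrow> i \<in> {1..n} \<and> u < \<tau> i \<and> a < s"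

lemma pos_less: "inside i u a \<Longrightarrow> pos i u a < N"
  unfolding inside_def pos_def N_def
  by (intro part_position_less) (auto intro: sblock_position_less)

lemma pos_cases:
  assumes "k < N"
  obtains i u a where "inside i u a" "k = pos i u a"
proof -
  obtain i x where i: "i \<in> {1..n}" "x < s * \<tau> i" "k = (\<Sum>i'\<in>{1..<i}. s * \<tau> i') + x"
    using part_position_cases[OF assms[unfolded N_def]] by blast
  obtain u a where "u < \<tau> i" "a < s" "x = s * u + a"
    using sblock_position_cases[OF i(2)] by blast
  with i show ?thesis using that[of i u a] by (simp add: inside_def pos_def)
qed

lemma sum_over_pos:
  fixes f :: "nat \<Rightarrow> 'b::comm_monoid_add"
  shows "sum f {..<N} = (\<Sum>i\<in>{1..n}. \<Sum>u<\<tau> i. \<Sum>a<s. f (pos i u a))"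
  unfolding N_def sum_over_parts sum_over_sblocks pos_def ..

lemma mat_eq_by_pos:
  assumes "A \<in> carrier_mat N N" "B \<in> carrier_mat N N"
    and "\<And>i u a j v b. inside i u a \<Longrightarrow> inside j v b \<Longrightarrow>
      A $$ (pos i u a, pos j v b) = B $$ (pos i u a, pos j v b)"
  shows "A = B"
  using assms by (intro eq_matI) (auto elim!: pos_cases)

definition assemble :: "(nat \<Rightarrow> nat \<Rightarrow> nat \<Rightarrow> nat \<Rightarrow> 'a mat) \<Rightarrow> 'a mat" where
  "assemble k = block_mat n (\<lambda>i. s * \<tau> i) (\<lambda>i j. mat_of_sblocks s (\<tau> i) (\<tau> j) (k i j))"

lemma assemble_carrier [simp]: "assemble k \<in> carrier_mat N N"
  by (simp add: assemble_def N_def carrier_matI)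

lemma assemble_index:
  assumes "inside i u a" "inside j v b"
  shows "assemble k $$ (pos i u a, pos j v b) = k i j u v $$ (a, b)"
  using assms unfolding assemble_def pos_def inside_def
  by (subst block_mat_index) (auto simp: sblock_position_less)

text \<open>
  With zero blocks out of range, in particular at \<open>j = 0\<close> and \<open>i = n + 1\<close>, the equations at the
  border take the same form as those inside.
\<close>

definition supported :: "(nat \<Rightarrow> nat \<Rightarrow> nat \<Rightarrow> nat \<Rightarrow> 'a mat) \<Rightarrow> bool" where
  "supported k \<longleftrightarrow> (\<forall>i j u v. k i j u v \<in> carrier_mat s s \<and>
     (i \<notin> {1..n} \<or> j \<notin> {1..n} \<or> \<tau> i \<le> u \<or> \<tau> j \<le> v \<longrightarrow> k i j u v = 0\<^sub>m s s))"

lemma ex_blocks: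
  assumes M: "M \<in> carrier_mat N N"
  obtains k where "supported k" "M = assemble k"
proof
  let ?k = "\<lambda>i j u v. if i \<in> {1..n} \<and> j \<in> {1..n} \<and> u < \<tau> i \<and> v < \<tau> j
    then mat s s (\<lambda>(a, b). M $$ (pos i u a, pos j v b)) else 0\<^sub>m s s"
  show "supported ?k" by (auto simp: supported_def)
  show "M = assemble ?k"
    using M by (rule mat_eq_by_pos) (simp_all add: assemble_index, simp add: inside_def)
qed

definition weyr :: "'a mat" where
  "weyr = assemble (\<lambda>i j u v. if u \<noteq> v then 0\<^sub>m s s
     else if j = i then C else if j = i + 1 then E else 0\<^sub>m s s)"

lemma weyr_index:
  assumes "inside i u a" "inside j v b"
  shows "weyr $$ (pos i u a, pos j v b) =
    (if j = i \<and> v = u then C $$ (a, b) else 0) + (if j = i + 1 \<and> v = u then E $$ (a, b) else 0)"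
  using assms unfolding weyr_def by (simp add: assemble_index) (auto simp: inside_def)

lemma sum_blocks_delta:
  fixes z :: "nat \<Rightarrow> nat \<Rightarrow> 'b::comm_monoid_add"
  assumes "\<not> (i \<in> {1..n} \<and> u < \<tau> i) \<Longrightarrow> x = 0"
  shows "(\<Sum>i'\<in>{1..n}. \<Sum>u'<\<tau> i'. if i' = i \<and> u' = u then x else 0) = x"
proof -
  have "(\<Sum>u'<\<tau> i'. if i' = i \<and> u' = u then x else 0) = (if i' = i then if u < \<tau> i then x else 0 else 0)" for i'
    by auto
  then show ?thesis using assms by auto
qed

lemma mult_index_sum:
  assumes "A \<in> carrier_mat m m" "B \<in> carrier_mat m m" "k < m" "l < m"
  shows "(A * B) $$ (k, l) = (\<Sum>x<m. A $$ (k, x) * B $$ (x, l))"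
  using assms by (simp add: scalar_prod_def lessThan_atLeast0)

lemma weyr_mult_index:
  assumes k: "supported k" and i: "inside i u a" and j: "inside j v b"
  shows "(weyr * assemble k) $$ (pos i u a, pos j v b) =
    (C * k i j u v + E * k (i + 1) j u v) $$ (a, b)"
proof -
  have kc [simp]: "k i j u v \<in> carrier_mat s s" for i j u v
    using k by (simp add: supported_def)
  have kd [simp]: "dim_row (k i j u v) = s" "dim_col (k i j u v) = s" for i j u v
    using kc by blast+
  have ab: "a < s" "b < s" using i j by (simp_all add: inside_def)
  have "(weyr * assemble k) $$ (pos i u a, pos j v b) =
    (\<Sum>i'\<in>{1..n}. \<Sum>u'<\<tau> i'. \<Sum>a'<s.
      weyr $$ (pos i u a, pos i' u' a') * assemble k $$ (pos i' u' a', pos j v b))"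
    using pos_less[OF i] pos_less[OF j]
    by (simp add: mult_index_sum[of _ N] weyr_def sum_over_pos del: index_mult_mat)
  also have "\<dots> = (\<Sum>i'\<in>{1..n}. \<Sum>u'<\<tau> i'. \<Sum>a'<s.
      (if i' = i \<and> u' = u then C $$ (a, a') * k i j u v $$ (a', b) else 0) +
      (if i' = i + 1 \<and> u' = u then E $$ (a, a') * k (i + 1) j u v $$ (a', b) else 0))"
  proof (intro sum.cong refl)
    fix i' u' a' assume "i' \<in> {1..n}" "u' \<in> {..<\<tau> i'}" "a' \<in> {..<s}"
    then have "inside i' u' a'" by (simp add: inside_def)
    then show "weyr $$ (pos i u a, pos i' u' a') * assemble k $$ (pos i' u' a', pos j v b) =
      (if i' = i \<and> u' = u then C $$ (a, a') * k i j u v $$ (a', b) else 0) +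
      (if i' = i + 1 \<and> u' = u then E $$ (a, a') * k (i + 1) j u v $$ (a', b) else 0)"
      using i j by (simp add: weyr_index assemble_index)
  qed
  also have "\<dots> = (\<Sum>i'\<in>{1..n}. \<Sum>u'<\<tau> i'.
      (if i' = i \<and> u' = u then (C * k i j u v) $$ (a, b) else 0) +
      (if i' = i + 1 \<and> u' = u then (E * k (i + 1) j u v) $$ (a, b) else 0))"
    using ab by (intro sum.cong refl)
      (simp add: sum.distrib sum_if_const mult_index_sum[of _ s] del: index_mult_mat)
  also have "\<dots> = (C * k i j u v) $$ (a, b) + (E * k (i + 1) j u v) $$ (a, b)"
  proof -
    have *: "k (i + 1) j u v = 0\<^sub>m s s" if "\<not> (i + 1 \<in> {1..n} \<and> u < \<tau> (i + 1))"
      using k that by (auto simp: supported_def)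
    have "(E * k (i + 1) j u v) $$ (a, b) = 0" if "\<not> (i + 1 \<in> {1..n} \<and> u < \<tau> (i + 1))"
      using *[OF that] ab right_mult_zero_mat[of E s s s] by simp
    then show ?thesis
      using i unfolding sum.distrib
      by (subst (1 2) sum_blocks_delta) (auto simp: inside_def simp del: index_mult_mat)
  qed
  finally show ?thesis using ab by (simp del: index_mult_mat(1))
qed

lemma mult_weyr_index:
  assumes k: "supported k" and i: "inside i u a" and j: "inside j v b"
  shows "(assemble k * weyr) $$ (pos i u a, pos j v b) =
    (k i j u v * C + k i (j - 1) u v * E) $$ (a, b)"
proof -
  have kc [simp]: "k i j u v \<in> carrier_mat s s" for i j u v
    using k by (simp add: supported_def)
  have kd [simp]: "dim_row (k i j u v) = s" "dim_col (k i j u v) = s" for i j u v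
    using kc by blast+
  have ab: "a < s" "b < s" using i j by (simp_all add: inside_def)
  have j1: "1 \<le> j" using j by (simp add: inside_def)
  have "(assemble k * weyr) $$ (pos i u a, pos j v b) =
    (\<Sum>j'\<in>{1..n}. \<Sum>v'<\<tau> j'. \<Sum>b'<s.
      assemble k $$ (pos i u a, pos j' v' b') * weyr $$ (pos j' v' b', pos j v b))"
    using pos_less[OF i] pos_less[OF j]
    by (simp add: mult_index_sum[of _ N] weyr_def sum_over_pos del: index_mult_mat)
  also have "\<dots> = (\<Sum>j'\<in>{1..n}. \<Sum>v'<\<tau> j'. \<Sum>b'<s.
      (if j' = j \<and> v' = v then k i j u v $$ (a, b') * C $$ (b', b) else 0) +
      (if j' = j - 1 \<and> v' = v then k i (j - 1) u v $$ (a, b') * E $$ (b', b) else 0))"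
  proof (intro sum.cong refl)
    fix j' v' b' assume "j' \<in> {1..n}" "v' \<in> {..<\<tau> j'}" "b' \<in> {..<s}"
    then have "inside j' v' b'" by (simp add: inside_def)
    moreover have "j = j' + 1 \<longleftrightarrow> j' = j - 1" using j1 by auto
    ultimately show "assemble k $$ (pos i u a, pos j' v' b') * weyr $$ (pos j' v' b', pos j v b) =
      (if j' = j \<and> v' = v then k i j u v $$ (a, b') * C $$ (b', b) else 0) +
      (if j' = j - 1 \<and> v' = v then k i (j - 1) u v $$ (a, b') * E $$ (b', b) else 0)"
      using i j by (auto simp add: weyr_index assemble_index)
  qed
  also have "\<dots> = (\<Sum>j'\<in>{1..n}. \<Sum>v'<\<tau> j'.
      (if j' = j \<and> v' = v then (k i j u v * C) $$ (a, b) else 0) +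
      (if j' = j - 1 \<and> v' = v then (k i (j - 1) u v * E) $$ (a, b) else 0))"
    using ab by (intro sum.cong refl)
      (simp add: sum.distrib sum_if_const mult_index_sum[of _ s] del: index_mult_mat)
  also have "\<dots> = (k i j u v * C) $$ (a, b) + (k i (j - 1) u v * E) $$ (a, b)"
  proof -
    have *: "k i (j - 1) u v = 0\<^sub>m s s" if "\<not> (j - 1 \<in> {1..n} \<and> v < \<tau> (j - 1))"
      using k that by (auto simp: supported_def)
    have "(k i (j - 1) u v * E) $$ (a, b) = 0" if "\<not> (j - 1 \<in> {1..n} \<and> v < \<tau> (j - 1))"
      using *[OF that] ab left_mult_zero_mat[of E s s s] by simp
    then show ?thesis
      using j unfolding sum.distrib
      by (subst (1 2) sum_blocks_delta) (auto simp: inside_def simp del: index_mult_mat)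
  qed
  finally show ?thesis using ab by (simp del: index_mult_mat(1))
qed

lemma assemble_in_centralizer_iff:
  assumes k: "supported k"
  shows "assemble k \<in> centralizer weyr \<longleftrightarrow>
    (\<forall>i\<in>{1..n}. \<forall>j\<in>{1..n}. \<forall>u<\<tau> i. \<forall>v<\<tau> j.
       C * k i j u v + E * k (i + 1) j u v = k i j u v * C + k i (j - 1) u v * E)"
    (is "_ \<longleftrightarrow> ?eqs")
proof -
  have kc [simp]: "k i j u v \<in> carrier_mat s s" for i j u v
    using k by (simp add: supported_def)
  have kd [simp]: "dim_row (k i j u v) = s" "dim_col (k i j u v) = s" for i j u v
    using kc by blast+
  have wc: "weyr \<in> carrier_mat N N" by (simp add: weyr_def)
  have "assemble k \<in> centralizer weyr \<longleftrightarrow> weyr * assemble k = assemble k * weyr"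
    using wc by (auto simp: centralizer_def)
  also have "\<dots> \<longleftrightarrow> ?eqs"
  proof
    assume eq: "weyr * assemble k = assemble k * weyr"
    show ?eqs
    proof (intro ballI allI impI)
      fix i j u v assume ij: "i \<in> {1..n}" "j \<in> {1..n}" "u < \<tau> i" "v < \<tau> j"
      show "C * k i j u v + E * k (i + 1) j u v = k i j u v * C + k i (j - 1) u v * E"
      proof (rule eq_matI)
        fix a b assume "a < dim_row (k i j u v * C + k i (j - 1) u v * E)"
          "b < dim_col (k i j u v * C + k i (j - 1) u v * E)"
        then have "inside i u a" "inside j v b" using ij by (simp_all add: inside_def)
        then show "(C * k i j u v + E * k (i + 1) j u v) $$ (a, b) =
            (k i j u v * C + k i (j - 1) u v * E) $$ (a, b)"
          using weyr_mult_index[OF k] mult_weyr_index[OF k] eq by metis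
      qed simp_all
    qed
  next
    assume eqs: ?eqs
    show "weyr * assemble k = assemble k * weyr"
    proof (rule mat_eq_by_pos)
      fix i u a j v b assume *: "inside i u a" "inside j v b"
      then show "(weyr * assemble k) $$ (pos i u a, pos j v b) = (assemble k * weyr) $$ (pos i u a, pos j v b)"
        using eqs unfolding weyr_mult_index[OF k *] mult_weyr_index[OF k *]
        by (simp add: inside_def del: index_mult_mat index_add_mat)
    qed (use wc in \<open>simp_all add: mult_carrier_mat[of _ N N _ N]\<close>)
  qed
  finally show ?thesis .
qed


lemma supportedD:
  assumes "supported k"
  shows "k i j u v \<in> carrier_mat s s" "dim_row (k i j u v) = s" "dim_col (k i j u v) = s"
    and "i \<notin> {1..n} \<or> j \<notin> {1..n} \<or> \<tau> i \<le> u \<or> \<tau> j \<le> v \<Longrightarrow> k i j u v = 0\<^sub>m s s"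
proof -
  show *: "k i j u v \<in> carrier_mat s s" using assms by (simp add: supported_def)
  then show "dim_row (k i j u v) = s" "dim_col (k i j u v) = s" by blast+
qed (use assms in \<open>simp add: supported_def\<close>)

lemma tilde_block_zero [simp]: "tilde_block s (0\<^sub>m s s) = (0\<^sub>m s s :: 'a mat)"
  by (intro eq_matI) (auto simp: tilde_block_def)

lemma zero_minus_zero [simp]: "0\<^sub>m s s - 0\<^sub>m s s = (0\<^sub>m s s :: 'a mat)"
  by (intro eq_matI) auto

lemma minus_add_cancel_mat:
  assumes "A \<in> carrier_mat s s" "B \<in> carrier_mat s s"
  shows "A - B + B = (A :: 'a mat)" "A + B - B = A"
  using assms by (auto intro!: eq_matI)

lemma \<tau>_antimono: "i \<le> j \<Longrightarrow> \<tau> j \<le> \<tau> i"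
  by (rule lift_Suc_antimono_le) (rule \<tau>_Suc_le)

definition diagonally_linked :: "(nat \<Rightarrow> nat \<Rightarrow> nat \<Rightarrow> nat \<Rightarrow> 'a mat) \<Rightarrow> bool" where
  "diagonally_linked k \<longleftrightarrow>
     (\<forall>i\<ge>1. \<forall>j\<ge>1. \<forall>u. \<forall>v<\<tau> j. k i (j - 1) u v = k (i + 1) j u v)"

definition tilde_linked :: "(nat \<Rightarrow> nat \<Rightarrow> nat \<Rightarrow> nat \<Rightarrow> 'a mat) \<Rightarrow> bool" where
  "tilde_linked k \<longleftrightarrow>
     (\<forall>i\<ge>1. \<forall>j u v. k i j u v - tilde_block s (k (i + 1) j u v) \<in> centralizer C)"

text \<open>
  The measure \<open>(n + 1 - i) + j\<close> counts the block diagonals from the lower left corner. Both neighbours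
  of a block lie on the preceding diagonal, and by induction the tildes that belong to them come from
  \<open>k (i + 1) (j - 1) u v\<close> and \<open>k (i + 2) j u v\<close>, which are equal by induction as well.
\<close>

lemma linked_of_block_equations:
  assumes k: "supported k"
    and eqs: "\<And>i j u v. i \<in> {1..n} \<Longrightarrow> j \<in> {1..n} \<Longrightarrow> u < \<tau> i \<Longrightarrow> v < \<tau> j \<Longrightarrow>
       C * k i j u v + E * k (i + 1) j u v = k i j u v * C + k i (j - 1) u v * E"
    and "1 \<le> i" "1 \<le> j" "v < \<tau> j"
  shows "k i (j - 1) u v = k (i + 1) j u v \<and>
    k i j u v - tilde_block s (k (i + 1) j u v) \<in> centralizer C"
  using assms(3-)
proof (induction "(n + 1 - i) + j" arbitrary: i j rule: less_induct)
  case less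
  note [simp] = supportedD(1-3)[OF k]
  note zero = supportedD(4)[OF k]
  have v: "v < \<tau> (j - 1)"
    using less.prems(3) \<tau>_antimono[of "j - 1" j] by simp
  have j: "j \<in> {1..n}"
    using less.prems \<tau>_zero[of j] by (cases "n < j") auto
  show ?case
  proof (cases "i \<le> n \<and> u < \<tau> i")
    case False
    then have "i \<notin> {1..n} \<or> \<tau> i \<le> u" "i + 1 \<notin> {1..n} \<or> \<tau> (i + 1) \<le> u"
      using \<tau>_Suc_le[of i] by auto
    then show ?thesis by (auto simp: zero)
  next
    case True
    let ?Y = "k (i + 1) (j - 1) u v"
    have Z1: "k i (j - 1) u v - tilde_block s ?Y \<in> centralizer C"
    proof (cases "j = 1")
      case True
      then show ?thesis by (simp add: zero)
    next
      case False
      then show ?thesis using less.hyps[of i "j - 1"] less.prems v by simp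
    qed
    have Z2: "k (i + 1) j u v - tilde_block s ?Y \<in> centralizer C"
    proof -
      have "n + 1 - (i + 1) + j < n + 1 - i + j" using True by linarith
      from less.hyps[OF this] show ?thesis using less.prems by simp
    qed
    show ?thesis
      using commutator_solutions[of "k i j u v", OF _ Z1 Z2, where Y = ?Y
          and ?B1.0 = "k i (j - 1) u v" and ?B2.0 = "k (i + 1) j u v"]
        eqs[of i j u v] True less.prems j
      by (simp add: minus_add_cancel_mat)
  qed
qed

text \<open>
  Here \<open>A - tilde_block s B\<close> commutes with \<open>C\<close>, where \<open>B\<close> is the lower neighbour of \<open>A\<close>, and \<open>B\<close> itself
  is an element of \<open>Z(C)\<close> plus a tilde; so the commutator of \<open>A\<close> is that of the particular solution.
\<close>

lemma block_equations_of_linked: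
  assumes k: "supported k" and a: "diagonally_linked k" and b: "tilde_linked k"
    and ij: "1 \<le> i" "1 \<le> j" and v: "v < \<tau> j"
  shows "C * k i j u v + E * k (i + 1) j u v = k i j u v * C + k i (j - 1) u v * E"
proof -
  note [simp] = supportedD(1-3)[OF k]
  let ?B = "k (i + 1) j u v" and ?A = "k i j u v"
  let ?T = "tilde_block s ?B"
  define Z where "Z = ?A - ?T"
  have Z: "Z \<in> centralizer C" using b ij by (simp add: Z_def tilde_linked_def)
  have [simp]: "Z \<in> carrier_mat s s" by (simp add: Z_def)
  have CZ: "C * Z = Z * C" using Z by (simp add: centralizer_C_iff)
  have A: "?A = Z + ?T" by (simp add: Z_def minus_add_cancel_mat)
  have "?B = (?B - tilde_block s (k (i + 2) j u v)) + tilde_block s (k (i + 2) j u v)"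
    by (simp add: minus_add_cancel_mat)
  moreover have "?B - tilde_block s (k (i + 2) j u v) \<in> centralizer C"
    using b[unfolded tilde_linked_def, rule_format, of "i + 1" j u v] by simp
  ultimately have comm: "C * ?T - ?T * C = ?B * E - E * ?B"
    by (rule tilde_block_commutator'[rotated])
  have "C * ?A = C * Z + C * ?T" "?A * C = C * Z + ?T * C"
    unfolding A CZ by (simp_all add: CZ mult_add_distrib_mat[of _ s s _ s] add_mult_distrib_mat[of _ s s _ _ s])
  moreover have "C * Z + C * ?T + E * ?B = C * Z + ?T * C + ?B * E"
  proof (rule eq_matI)
    fix x y assume "x < dim_row (C * Z + ?T * C + ?B * E)" "y < dim_col (C * Z + ?T * C + ?B * E)"
    then have xy: "x < s" "y < s" by simp_all
    have "(C * ?T) $$ (x, y) - (?T * C) $$ (x, y) = (?B * E) $$ (x, y) - (E * ?B) $$ (x, y)"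
      using xy arg_cong[OF comm, of "\<lambda>M. M $$ (x, y)"] by (simp del: index_mult_mat(1))
    then have "(C * ?T) $$ (x, y) = (?B * E) $$ (x, y) - (E * ?B) $$ (x, y) + (?T * C) $$ (x, y)"
      by (simp only: diff_eq_eq)
    then show "(C * Z + C * ?T + E * ?B) $$ (x, y) = (C * Z + ?T * C + ?B * E) $$ (x, y)"
      using xy carrier_matD[OF \<open>Z \<in> carrier_mat s s\<close>] by (simp del: index_mult_mat(1))
  qed (simp_all add: carrier_matD[OF \<open>Z \<in> carrier_mat s s\<close>])
  moreover have "k i (j - 1) u v = ?B"
    using a ij v by (simp add: diagonally_linked_def)
  ultimately show ?thesis by simp
qed

lemma assemble_in_centralizer_iff_linked:
  assumes k: "supported k"
  shows "assemble k \<in> centralizer weyr \<longleftrightarrow> diagonally_linked k \<and> tilde_linked k"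
proof
  assume "assemble k \<in> centralizer weyr"
  then have eqs: "C * k i j u v + E * k (i + 1) j u v = k i j u v * C + k i (j - 1) u v * E"
    if "i \<in> {1..n}" "j \<in> {1..n}" "u < \<tau> i" "v < \<tau> j" for i j u v
    using that by (simp add: assemble_in_centralizer_iff[OF k])
  have "k i j u v - tilde_block s (k (i + 1) j u v) \<in> centralizer C" if i: "1 \<le> i" for i j u v
  proof (cases "1 \<le> j \<and> v < \<tau> j")
    case True
    then show ?thesis using linked_of_block_equations[OF k eqs i] by blast
  next
    case False
    then have "k i j u v = 0\<^sub>m s s" for i by (intro supportedD(4)[OF k]) auto
    then show ?thesis by simp
  qed
  then show "diagonally_linked k \<and> tilde_linked k"
    using linked_of_block_equations[OF k eqs]
    unfolding diagonally_linked_def tilde_linked_def by blast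
next
  assume "diagonally_linked k \<and> tilde_linked k"
  then show "assemble k \<in> centralizer weyr"
    using block_equations_of_linked[OF k] by (simp add: assemble_in_centralizer_iff[OF k])
qed

lemma linked_shift:
  assumes "diagonally_linked k" "1 \<le> i" "v < \<tau> (j + 1)"
  shows "k i j u v = k (i + 1) (j + 1) u v"
  using assms(1)[unfolded diagonally_linked_def, rule_format, of i "j + 1" v u] assms(2,3) by simp

text \<open>
  Moving up along the diagonal ends in the column \<open>j = 0\<close>, out of range.
\<close>

lemma linked_lower_zero:
  assumes k: "supported k" and a: "diagonally_linked k" and "j < i"
  shows "k i j u v = 0\<^sub>m s s"
  using assms(3)
proof (induction j arbitrary: i)
  case 0
  then show ?case by (simp add: supportedD(4)[OF k])
next
  case (Suc j)
  show ?case
  proof (cases "v < \<tau> (Suc j)")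
    case True
    then have "k (i - 1) j u v = k i (Suc j) u v"
      using Suc.prems linked_shift[OF a, of "i - 1" v j u] by simp
    then show ?thesis using Suc.IH[of "i - 1"] Suc.prems by simp
  next
    case False
    then show ?thesis by (simp add: supportedD(4)[OF k])
  qed
qed


section \<open>Parameters and the recursive construction\<close>

abbreviation step :: "nat \<Rightarrow> nat" where "step j \<equiv> \<tau> j - \<tau> (j + 1)"

text \<open>
  As \<open>\<tau> (n + 1) = 0\<close>, the conditions for \<open>j = i\<close>, \<open>i < j < n\<close> and \<open>j = n\<close> are instances of a single one.
\<close>

lemma free_params_iff:
  "free_params s \<tau> n Z D X Yd Y' \<longleftrightarrow>
     D \<in> sblock_mats s (\<tau> n) (\<tau> n) Z \<and>
     (\<forall>i\<in>{1..<n}. \<forall>j\<in>{i..n}.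
        X i j \<in> sblock_mats s (step i) (step j) Z \<and>
        (if j = i then Yd i else Y' i j) \<in> sblock_mats s (\<tau> (i + 1)) (step j) Z) \<and>
     X n n = 0\<^sub>m 0 (s * \<tau> n)" (is "?L \<longleftrightarrow> ?R")
proof -
  have last: "step n = \<tau> n" using \<tau>_zero[of "n + 1"] by simp
  have range: "j \<in> {i..n} \<longleftrightarrow> j = i \<or> j = n \<or> j \<in> {i + 1..<n}" if "i \<in> {1..<n}" for i j
    using that by auto
  have "(\<forall>i\<in>{1..<n}. \<forall>j\<in>{i..n}.
        X i j \<in> sblock_mats s (step i) (step j) Z \<and>
        (if j = i then Yd i else Y' i j) \<in> sblock_mats s (\<tau> (i + 1)) (step j) Z) \<longleftrightarrow>
    (\<forall>i\<in>{1..<n}.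
       (X i i \<in> sblock_mats s (step i) (step i) Z \<and> Yd i \<in> sblock_mats s (\<tau> (i + 1)) (step i) Z) \<and>
       (X i n \<in> sblock_mats s (step i) (\<tau> n) Z \<and> Y' i n \<in> sblock_mats s (\<tau> (i + 1)) (\<tau> n) Z) \<and>
       (\<forall>j\<in>{i + 1..<n}. X i j \<in> sblock_mats s (step i) (step j) Z \<and>
          Y' i j \<in> sblock_mats s (\<tau> (i + 1)) (step j) Z))"
  proof (intro ball_cong refl)
    fix i assume i: "i \<in> {1..<n}"
    show "(\<forall>j\<in>{i..n}.
        X i j \<in> sblock_mats s (step i) (step j) Z \<and>
        (if j = i then Yd i else Y' i j) \<in> sblock_mats s (\<tau> (i + 1)) (step j) Z) \<longleftrightarrow>
       (X i i \<in> sblock_mats s (step i) (step i) Z \<and> Yd i \<in> sblock_mats s (\<tau> (i + 1)) (step i) Z) \<and>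
       (X i n \<in> sblock_mats s (step i) (\<tau> n) Z \<and> Y' i n \<in> sblock_mats s (\<tau> (i + 1)) (\<tau> n) Z) \<and>
       (\<forall>j\<in>{i + 1..<n}. X i j \<in> sblock_mats s (step i) (step j) Z \<and>
          Y' i j \<in> sblock_mats s (\<tau> (i + 1)) (step j) Z)"
      unfolding Ball_def range[OF i] using i last by (auto split: if_splits)
  qed
  then show ?thesis unfolding free_params_def by blast
qed

text \<open>
  The free summand of the block at \<open>(u, v + \<tau> (j + 1))\<close>: the columns of \<open>k i j\<close> not covered by
  \<open>k (i + 1) (j + 1)\<close> are filled by \<open>Y\<close> above row \<open>\<tau> (i + 1)\<close> and by \<open>X\<close> below it. For \<open>i = n\<close> the two
  parts trade places: \<open>\<tau> (n + 1) = 0\<close> would put everything into \<open>X n n\<close>, but the construction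
  sets \<open>Y n n = K n n\<close> and leaves \<open>X n n\<close> empty.
\<close>

definition param_block where
  "param_block D X Yd Y' i j u v =
     (if i = n then sblock s D u v
      else if u < \<tau> (i + 1) then sblock s (if j = i then Yd i else Y' i j) u v
      else sblock s (X i j) (u - \<tau> (i + 1)) v)"

text \<open>
  The tilde is present for every \<open>u < \<tau> i\<close>, not only above row \<open>\<tau> (i + 1)\<close>: for supported blocks
  it vanishes in the rows of \<open>X\<close> because \<open>k (i + 1) j\<close> has no such rows, and for
  diagonally linked ones also at \<open>i = j\<close>, because \<open>k (i + 1) i\<close> is zero.
\<close>

definition param_linked where
  "param_linked D X Yd Y' k \<longleftrightarrow> (\<forall>i j u v. 1 \<le> i \<and> i \<le> j \<and> j \<le> n \<and> u < \<tau> i \<and> \<tau> (j + 1) \<le> v \<and> v < \<tau> j \<longrightarrow>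
     k i j u v = param_block D X Yd Y' i j u (v - \<tau> (j + 1)) + tilde_block s (k (i + 1) j u v))"

lemma param_block_closed:
  assumes "free_params s \<tau> n Z D X Yd Y'" "1 \<le> i" "i \<le> j" "j \<le> n" "u < \<tau> i" "v < step j"
  shows "param_block D X Yd Y' i j u v \<in> Z"
proof (cases "i = n")
  case True
  then have "j = n" using assms(3,4) by simp
  then have "v < \<tau> n" "u < \<tau> n" using assms(5,6) True by simp_all
  moreover have "D \<in> sblock_mats s (\<tau> n) (\<tau> n) Z" using assms(1) by (simp add: free_params_iff)
  ultimately show ?thesis using True by (simp add: param_block_def sblock_mats_def)
next
  case False
  then have "i \<in> {1..<n}" "j \<in> {i..n}" using assms by auto
  then have "X i j \<in> sblock_mats s (step i) (step j) Z"
    "(if j = i then Yd i else Y' i j) \<in> sblock_mats s (\<tau> (i + 1)) (step j) Z"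
    using assms(1) by (auto simp: free_params_iff)
  then show ?thesis
    using assms(5,6) False by (simp add: param_block_def sblock_mats_def)
qed

text \<open>
  All matrix identities of the construction are compared in each \<open>s \<times> s\<close> block. The columns of
  \<open>k i j\<close> from \<open>\<tau> (j + 1)\<close> on form \<open>Y i j @\<^sub>r X i j\<close>, for \<open>i = n\<close> too; this makes the tilde in the
  recursion for \<open>Y\<close> the tilde of the lower neighbour.
\<close>

lemma built_from_blocks:
  assumes k: "supported k" and a: "diagonally_linked k"
    and f: "free_params s \<tau> n Z D X Yd Y'"
    and pl: "param_linked D X Yd Y' k"
  shows "\<exists>Y K. built_from s \<tau> n D X Yd Y' Y K \<and> assemble k = block_mat n (\<lambda>i. s * \<tau> i) K"
proof -
  note [simp] = supportedD(1-3)[OF k]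
  note zero = supportedD(4)[OF k]
  have \<tau>n [simp]: "\<tau> (Suc n) = 0" using \<tau>_zero by simp
  have \<tau>S: "\<tau> (i + 1) + step i = \<tau> i" for i using \<tau>_Suc_le[of i] by simp
  (* For n = 0 the construction still asks for K 0 0 = D, although there are no blocks to assemble. *)
  define K where "K i j = (if i = 0 then D else mat_of_sblocks s (\<tau> i) (\<tau> j) (k i j))" for i j
  define Y where "Y i j = (if i = n then D else
    mat_of_sblocks s (\<tau> (i + 1)) (step j) (\<lambda>u v. k i j u (v + \<tau> (j + 1))))" for i j
  have D: "D \<in> carrier_mat (s * \<tau> n) (s * \<tau> n)"
    using f by (simp add: free_params_iff sblock_mats_def)
  have X: "X i j \<in> carrier_mat (s * step i) (s * step j)"
    and Y': "j \<noteq> i \<Longrightarrow> Y' i j \<in> carrier_mat (s * \<tau> (i + 1)) (s * step j)"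
    and Yd: "Yd i \<in> carrier_mat (s * \<tau> (i + 1)) (s * step i)"
    if "i \<in> {1..<n}" "j \<in> {i..n}" for i j
  proof -
    have "X i j \<in> sblock_mats s (step i) (step j) Z"
      "(if j = i then Yd i else Y' i j) \<in> sblock_mats s (\<tau> (i + 1)) (step j) Z"
      "(if i = i then Yd i else Y' i i) \<in> sblock_mats s (\<tau> (i + 1)) (step i) Z"
      using f that unfolding free_params_iff by fastforce+
    then show "X i j \<in> carrier_mat (s * step i) (s * step j)"
      "j \<noteq> i \<Longrightarrow> Y' i j \<in> carrier_mat (s * \<tau> (i + 1)) (s * step j)"
      "Yd i \<in> carrier_mat (s * \<tau> (i + 1)) (s * step i)"
      by (simp_all add: sblock_mats_def)
  qed
  have Xn: "X n n = 0\<^sub>m 0 (s * \<tau> n)" using f by (simp add: free_params_iff)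
  have pl': "k i j u v = param_block D X Yd Y' i j u (v - \<tau> (j + 1)) + tilde_block s (k (i + 1) j u v)"
    if "1 \<le> i" "i \<le> j" "j \<le> n" "u < \<tau> i" "\<tau> (j + 1) \<le> v" "v < \<tau> j" for i j u v
    using pl that unfolding param_linked_def by blast
  have Kc: "K i j \<in> carrier_mat (s * \<tau> i) (s * \<tau> j)" if "1 \<le> i" for i j
    using that by (simp add: K_def)
  have Ks: "sblock s (K i j) u v = k i j u v" if "1 \<le> i" "u < \<tau> i" "v < \<tau> j" for i j u v
    using that by (simp add: K_def sblock_mat_of_sblocks)
  have Yc: "Y i j \<in> carrier_mat (s * \<tau> (i + 1)) (s * step j)" if "i < n" for i j
    using that by (simp add: Y_def)
  have Ys: "sblock s (Y i j) u v = k i j u (v + \<tau> (j + 1))" if "i < n" "u < \<tau> (i + 1)" "v < step j" for i j u v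
    using that by (simp add: Y_def sblock_mat_of_sblocks)
  have Xs: "sblock s (X i j) u v = k i j (u + \<tau> (i + 1)) (v + \<tau> (j + 1))"
    if "i \<in> {1..<n}" "j \<in> {i..n}" "u < step i" "v < step j" for i j u v
  proof -
    have "k (i + 1) j (u + \<tau> (i + 1)) (v + \<tau> (j + 1)) = 0\<^sub>m s s" by (rule zero) simp
    then show ?thesis
      using that pl'[of i j "u + \<tau> (i + 1)" "v + \<tau> (j + 1)"] by (simp add: param_block_def)
  qed
  have Ds: "sblock s D u v = k n n u v" if "1 \<le> n" "u < \<tau> n" "v < \<tau> n" for u v
  proof -
    have "k (n + 1) n u v = 0\<^sub>m s s" by (rule zero) simp
    then show ?thesis
      using that pl'[of n n u v] by (simp add: param_block_def)
  qed
  have KnD: "K n n = D"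
  proof (cases "n = 0")
    case False
    then have "1 \<le> n" by simp
    from mat_eq_by_sblocks[OF Kc[OF this] D] show ?thesis
      using Ks[OF \<open>1 \<le> n\<close>] Ds[OF \<open>1 \<le> n\<close>] by simp
  qed (simp add: K_def)
  have right_carrier: "Y i j @\<^sub>r X i j \<in> carrier_mat (s * \<tau> i) (s * step j)"
    if "1 \<le> i" "i \<le> j" "j \<le> n" for i j
  proof (cases "i = n")
    case True
    then have "j = n" using that by simp
    then show ?thesis using True D Xn by (simp add: Y_def append_rows_carrier_sblocks[of _ s "\<tau> n" _ _ 0])
  next
    case False
    then show ?thesis using that by (intro append_rows_carrier_sblocks[OF Yc X \<tau>S]) auto
  qed
  have right_sblock: "sblock s (Y i j @\<^sub>r X i j) u v = k i j u (v + \<tau> (j + 1))"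
    if "1 \<le> i" "i \<le> j" "j \<le> n" "u < \<tau> i" "v < step j" for i j u v
  proof (cases "i = n")
    case True
    then have j: "j = n" using that by simp
    then have "sblock s (Y i j @\<^sub>r X i j) u v = sblock s D u v"
      using True D Xn that by (subst sblock_append_rows[of _ s "\<tau> n" "\<tau> n" _ 0]) (simp_all add: Y_def)
    moreover have "\<tau> (j + 1) = 0" using j \<tau>_zero[of "j + 1"] by simp
    then have "k i j u (v + \<tau> (j + 1)) = k n n u v" "v < \<tau> n" "u < \<tau> n" "1 \<le> n"
      using True j that by (auto simp del: \<tau>n)
    ultimately show ?thesis using Ds by simp
  next
    case False
    then have i: "i \<in> {1..<n}" "j \<in> {i..n}" using that by simp_all
    then show ?thesis
      using that Ys[of i u v j] Xs[OF i, of "u - \<tau> (i + 1)" v]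
      by (subst sblock_append_rows[OF Yc X[OF i]]) auto
  qed
  have lower: "K i j = 0\<^sub>m (s * \<tau> i) (s * \<tau> j)" if "1 \<le> i" "j < i" for i j
    using that by (intro mat_eq_by_sblocks[OF Kc]) (simp_all add: Ks sblock_zero linked_lower_zero[OF k a])
  have diag: "Y i i = Yd i" if "i \<in> {1..<n}" for i
  proof (rule mat_eq_by_sblocks[OF Yc Yd])
    fix u v assume uv: "u < \<tau> (i + 1)" "v < step i"
    have "k (i + 1) i u (v + \<tau> (i + 1)) = 0\<^sub>m s s" by (rule linked_lower_zero[OF k a]) simp
    then show "sblock s (Y i i) u v = sblock s (Yd i) u v"
      using uv that \<tau>_Suc_le[of i] pl'[of i i u "v + \<tau> (i + 1)"] by (simp add: Ys param_block_def)
  qed (use that in auto)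
  have upper: "Y i j = Y' i j + tilde s (Y (i + 1) j @\<^sub>r X (i + 1) j)"
    if "i \<in> {1..<n}" "j \<in> {i + 1..n}" for i j
  proof (rule mat_eq_by_sblocks[of _ s "\<tau> (i + 1)" "step j"])
    have Rc: "Y (i + 1) j @\<^sub>r X (i + 1) j \<in> carrier_mat (s * \<tau> (i + 1)) (s * step j)"
      using that by (intro right_carrier) auto
    note Tc = tilde_carrier[OF Rc s_pos]
    show "Y i j \<in> carrier_mat (s * \<tau> (i + 1)) (s * step j)" using that Yc by simp
    show "Y' i j + tilde s (Y (i + 1) j @\<^sub>r X (i + 1) j) \<in> carrier_mat (s * \<tau> (i + 1)) (s * step j)"
      using Tc by auto
    fix u v assume uv: "u < \<tau> (i + 1)" "v < step j"
    then have "sblock s (tilde s (Y (i + 1) j @\<^sub>r X (i + 1) j)) u v =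
        tilde_block s (k (i + 1) j u (v + \<tau> (j + 1)))"
      using sblock_tilde[OF Rc uv s_pos] right_sblock[of "i + 1" j u v] that by simp
    then have "sblock s (Y' i j + tilde s (Y (i + 1) j @\<^sub>r X (i + 1) j)) u v =
        sblock s (Y' i j) u v + tilde_block s (k (i + 1) j u (v + \<tau> (j + 1)))"
      using sblock_add[OF Tc uv] by simp
    then show "sblock s (Y i j) u v = sblock s (Y' i j + tilde s (Y (i + 1) j @\<^sub>r X (i + 1) j)) u v"
      using uv that \<tau>_Suc_le[of i] pl'[of i j u "v + \<tau> (j + 1)"] by (simp add: Ys param_block_def)
  qed
  have split: "K i j = four_block_mat (K (i + 1) (j + 1)) (Y i j)
      (0\<^sub>m (s * step i) (s * \<tau> (j + 1))) (X i j)"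
    if i: "i \<in> {1..<n}" "j \<in> {i..n}" for i j
  proof (rule mat_eq_by_sblocks[of _ s "\<tau> i" "\<tau> j"])
    have Kc': "K (i + 1) (j + 1) \<in> carrier_mat (s * \<tau> (i + 1)) (s * \<tau> (j + 1))"
      by (rule Kc) simp
    show "K i j \<in> carrier_mat (s * \<tau> i) (s * \<tau> j)" using i Kc by simp
    show "four_block_mat (K (i + 1) (j + 1)) (Y i j) (0\<^sub>m (s * step i) (s * \<tau> (j + 1))) (X i j)
        \<in> carrier_mat (s * \<tau> i) (s * \<tau> j)"
      by (rule four_block_carrier_sblocks[OF Kc' X[OF i] \<tau>S \<tau>S])
    fix u v assume u: "u < \<tau> i" and v: "v < \<tau> j"
    have shift: "k i j u v = k (i + 1) (j + 1) u v" if "v < \<tau> (j + 1)"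
      using linked_shift[OF a _ that] i by simp
    have below: "k (i + 1) (j + 1) u v = 0\<^sub>m s s" if "\<not> u < \<tau> (i + 1)"
      by (rule zero) (use that in simp)
    show "sblock s (K i j) u v = sblock s (four_block_mat (K (i + 1) (j + 1)) (Y i j)
        (0\<^sub>m (s * step i) (s * \<tau> (j + 1))) (X i j)) u v"
      using i u v \<tau>S[of i] \<tau>S[of j] Ys[of i u "v - \<tau> (j + 1)" j]
        Xs[OF i, of "u - \<tau> (i + 1)" "v - \<tau> (j + 1)"] shift below
      by (subst sblock_four_block_mat[OF Kc' X[OF i]]) (auto simp: Ks sblock_zero)
  qed
  have last_col: "K i n = Y i n @\<^sub>r X i n" if "i \<in> {1..<n}" for i
  proof (rule mat_eq_by_sblocks[of _ s "\<tau> i" "\<tau> n"])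
    show "K i n \<in> carrier_mat (s * \<tau> i) (s * \<tau> n)" using Kc that by simp
    show "Y i n @\<^sub>r X i n \<in> carrier_mat (s * \<tau> i) (s * \<tau> n)"
      using right_carrier[of i n] that by simp
    fix u v assume "u < \<tau> i" "v < \<tau> n"
    then show "sblock s (K i n) u v = sblock s (Y i n @\<^sub>r X i n) u v"
      using that right_sblock[of i n u v] Ks[of i u v n] by simp
  qed
  have "built_from s \<tau> n D X Yd Y' Y K"
    unfolding built_from_def
  proof (intro conjI ballI)
    show "K n n = D" by (rule KnD)
    show "Y n n = K n n" using KnD by (simp add: Y_def)
  next
    fix i j assume "i \<in> {1..n}" "j \<in> {1..n}"
    then show "K i j \<in> carrier_mat (s * \<tau> i) (s * \<tau> j)" using Kc by simp
  next
    fix i j assume "i \<in> {1..n}" "j \<in> {1..<i}"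
    then show "K i j = 0\<^sub>m (s * \<tau> i) (s * \<tau> j)" by (intro lower) simp_all
  next
    fix i assume i: "i \<in> {1..<n}"
    show "Y i i = Yd i" by (rule diag[OF i])
    show "K i i = four_block_mat (K (i + 1) (i + 1)) (Y i i) (0\<^sub>m (s * step i) (s * \<tau> (i + 1))) (X i i)"
      by (rule split) (use i in simp_all)
    show "Y i n = Y' i n + tilde s (Y (i + 1) n @\<^sub>r X (i + 1) n)"
      by (rule upper) (use i in simp_all)
    show "K i n = Y i n @\<^sub>r X i n" by (rule last_col[OF i])
  next
    fix i j assume ij: "i \<in> {1..<n}" "j \<in> {i + 1..<n}"
    show "Y i j = Y' i j + tilde s (Y (i + 1) j @\<^sub>r X (i + 1) j)"
      by (rule upper) (use ij in simp_all)
    show "K i j = four_block_mat (K (i + 1) (j + 1)) (Y i j) (0\<^sub>m (s * step i) (s * \<tau> (j + 1))) (X i j)"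
      by (rule split) (use ij in simp_all)
  qed
  moreover have "assemble k = block_mat n (\<lambda>i. s * \<tau> i) K"
  proof (rule mat_eq_by_pos)
    show "block_mat n (\<lambda>i. s * \<tau> i) K \<in> carrier_mat N N" by (simp add: N_def carrier_matI)
    fix i u a j v b assume *: "inside i u a" "inside j v b"
    then have "block_mat n (\<lambda>i. s * \<tau> i) K $$ (pos i u a, pos j v b) = k i j u v $$ (a, b)"
      unfolding pos_def inside_def
      by (subst block_mat_index) (auto simp: sblock_position_less K_def)
    then show "assemble k $$ (pos i u a, pos j v b) =
        block_mat n (\<lambda>i. s * \<tau> i) K $$ (pos i u a, pos j v b)"
      using assemble_index[OF *] by simp
  qed simp
  ultimately show ?thesis by blast
qed

text \<open>
  The free elements are the differences that \<open>tilde_linked\<close> places in \<open>Z(C)\<close>. In the rows of \<open>X\<close>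
  the lower neighbour is out of range, so that there the block itself lies in \<open>Z(C)\<close>.
\<close>

lemma params_of_blocks:
  assumes k: "supported k" and b: "tilde_linked k"
  shows "\<exists>D X Yd Y'. free_params s \<tau> n (centralizer C) D X Yd Y' \<and> param_linked D X Yd Y' k"
proof -
  note [simp] = supportedD(1-3)[OF k]
  note zero = supportedD(4)[OF k]
  have \<tau>n [simp]: "\<tau> (Suc n) = 0" using \<tau>_zero by simp
  define D where "D = mat_of_sblocks s (\<tau> n) (\<tau> n) (k n n)"
  define X where "X i j = (if i = n then 0\<^sub>m 0 (s * \<tau> n) else
    mat_of_sblocks s (step i) (step j) (\<lambda>u v. k i j (u + \<tau> (i + 1)) (v + \<tau> (j + 1))))" for i j
  define Y' where "Y' i j = mat_of_sblocks s (\<tau> (i + 1)) (step j) (\<lambda>u v.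
    k i j u (v + \<tau> (j + 1)) - tilde_block s (k (i + 1) j u (v + \<tau> (j + 1))))" for i j
  have bottom: "k i j u v \<in> centralizer C" if "1 \<le> i" "\<tau> (i + 1) \<le> u" for i j u v
  proof -
    have "k (i + 1) j u v = 0\<^sub>m s s" using that by (intro zero) simp
    moreover have "k i j u v - 0\<^sub>m s s = k i j u v" by (intro eq_matI) simp_all
    ultimately show ?thesis using b that unfolding tilde_linked_def by (metis tilde_block_zero)
  qed
  have D: "D \<in> sblock_mats s (\<tau> n) (\<tau> n) (centralizer C)"
  proof -
    have "k n n u v \<in> centralizer C" for u v
      by (cases "n = 0") (simp add: zero, simp add: bottom)
    then show ?thesis by (simp add: D_def sblock_mats_def sblock_mat_of_sblocks)
  qed
  have X: "X i j \<in> sblock_mats s (step i) (step j) (centralizer C)" if "i \<in> {1..<n}" for i j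
    using that by (simp add: X_def sblock_mats_def sblock_mat_of_sblocks bottom)
  have Y': "Y' i j \<in> sblock_mats s (\<tau> (i + 1)) (step j) (centralizer C)" if "i \<in> {1..<n}" for i j
    using that b unfolding tilde_linked_def by (simp add: Y'_def sblock_mats_def sblock_mat_of_sblocks)
  have "free_params s \<tau> n (centralizer C) D X (\<lambda>i. Y' i i) Y'"
    using D X Y' by (simp add: free_params_iff) (simp add: X_def)
  moreover have "param_linked D X (\<lambda>i. Y' i i) Y' k"
    unfolding param_linked_def
  proof (intro allI impI, elim conjE)
    fix i j u v assume *: "1 \<le> i" "i \<le> j" "j \<le> n" "u < \<tau> i" "\<tau> (j + 1) \<le> v" "v < \<tau> j"
    have "param_block D X (\<lambda>i. Y' i i) Y' i j u (v - \<tau> (j + 1)) =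
      (if u < \<tau> (i + 1) then k i j u v - tilde_block s (k (i + 1) j u v) else k i j u v)"
      using * by (auto simp: param_block_def D_def X_def Y'_def sblock_mat_of_sblocks)
    moreover have "k (i + 1) j u v = 0\<^sub>m s s" if "\<not> u < \<tau> (i + 1)" using that by (intro zero) simp
    ultimately show "k i j u v = param_block D X (\<lambda>i. Y' i i) Y' i j u (v - \<tau> (j + 1))
        + tilde_block s (k (i + 1) j u v)"
      by (auto simp: minus_add_cancel_mat)
  qed
  ultimately show ?thesis by blast
qed

text \<open>
  The blocks with prescribed free summands \<open>P\<close>: a block in a column that \<open>k (i + 1) (j + 1)\<close>
  also has is a copy of the block there (zero if its row is out of range), and any other block is the
  sum of a free element and the tilde of its lower neighbour.
\<close>

function block_recursion :: "(nat \<Rightarrow> nat \<Rightarrow> nat \<Rightarrow> nat \<Rightarrow> 'a mat) \<Rightarrow> nat \<Rightarrow> nat \<Rightarrow> nat \<Rightarrow> nat \<Rightarrow> 'a mat" where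
  "block_recursion P i j u v =
     (if 1 \<le> i \<and> i \<le> j \<and> j \<le> n \<and> u < \<tau> i \<and> v < \<tau> j then
        if v < \<tau> (j + 1) then block_recursion P (i + 1) (j + 1) u v
        else P i j u (v - \<tau> (j + 1)) + tilde_block s (block_recursion P (i + 1) j u v)
      else 0\<^sub>m s s)"
  by auto
termination by (relation "measure (\<lambda>(P, i, j, u, v). n + 1 - i)") auto

declare block_recursion.simps [simp del]

lemma block_recursion_zero: "\<not> (1 \<le> i \<and> i \<le> j \<and> j \<le> n \<and> u < \<tau> i \<and> v < \<tau> j) \<Longrightarrow>
    block_recursion P i j u v = 0\<^sub>m s s"
  by (subst block_recursion.simps) auto

lemma supported_block_recursion: "supported (block_recursion P)"
proof -
  have "block_recursion P i j u v \<in> carrier_mat s s" for i j u v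
    by (induction P i j u v rule: block_recursion.induct) (subst block_recursion.simps, auto)
  then show ?thesis by (auto simp: supported_def block_recursion_zero)
qed

lemma diagonally_linked_block_recursion: "diagonally_linked (block_recursion P)"
  unfolding diagonally_linked_def
proof (intro allI impI)
  fix i j u v :: nat assume *: "1 \<le> i" "1 \<le> j" "v < \<tau> j"
  then obtain j' where j: "j = j' + 1" by (metis add.commute le_Suc_ex)
  show "block_recursion P i (j - 1) u v = block_recursion P (i + 1) j u v"
  proof (cases "i \<le> j' \<and> j' \<le> n \<and> u < \<tau> i \<and> v < \<tau> j'")
    case True
    then show ?thesis using * j by (subst block_recursion.simps) simp
  next
    case False
    have "v < \<tau> j'" using * j \<tau>_Suc_le[of j'] by simp
    moreover have "j' + 1 \<le> n" using * j \<tau>_zero[of j] by (cases "j \<le> n") auto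
    ultimately have "\<not> (i \<le> j' \<and> u < \<tau> i)" using False by simp
    then show ?thesis
      using j \<tau>_Suc_le[of i] by (subst (1 2) block_recursion_zero) auto
  qed
qed

text \<open>
  Only the columns from \<open>\<tau> (j + 1)\<close> on have this property by definition. In the others, both the block
  and its lower neighbour are copies of their diagonal neighbours, so that the property is passed on.
\<close>

lemma tilde_linked_block_recursion:
  assumes P: "\<And>i j u v. 1 \<le> i \<Longrightarrow> i \<le> j \<Longrightarrow> j \<le> n \<Longrightarrow> u < \<tau> i \<Longrightarrow> v < step j \<Longrightarrow> P i j u v \<in> centralizer C"
  shows "tilde_linked (block_recursion P)"
proof -
  note [simp] = supportedD(1-3)[OF supported_block_recursion]
  have "block_recursion P i j u v - tilde_block s (block_recursion P (i + 1) j u v) \<in> centralizer C"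
    if "1 \<le> i" for i j u v
    using that P
  proof (induction P i j u v rule: block_recursion.induct)
    case (1 P i j u v)
    show ?case
    proof (cases "i \<le> j \<and> j \<le> n \<and> u < \<tau> i \<and> v < \<tau> j")
      case False
      then have "block_recursion P i j u v = 0\<^sub>m s s" "block_recursion P (i + 1) j u v = 0\<^sub>m s s"
        using \<tau>_Suc_le[of i] by (auto intro!: block_recursion_zero)
      then show ?thesis by simp
    next
      case True
      show ?thesis
      proof (cases "v < \<tau> (j + 1)")
        case v: True
        have "block_recursion P i j u v = block_recursion P (i + 1) (j + 1) u v"
          using 1(3) v by (intro linked_shift[OF diagonally_linked_block_recursion]) auto
        moreover have "block_recursion P (i + 1) j u v = block_recursion P (i + 2) (j + 1) u v"
          using linked_shift[OF diagonally_linked_block_recursion, of "i + 1" v j P u] v by simp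
        ultimately show ?thesis using 1(1) 1(3,4) True v by simp
      next
        case v: False
        have c: "P i j u (v - \<tau> (j + 1)) \<in> centralizer C" using 1(3,4) True v by auto
        have "block_recursion P i j u v = P i j u (v - \<tau> (j + 1)) + tilde_block s (block_recursion P (i + 1) j u v)"
          using 1(3) True v by (subst block_recursion.simps) simp
        then show ?thesis using c by (simp add: minus_add_cancel_mat centralizer_C_iff)
      qed
    qed
  qed
  then show ?thesis by (simp add: tilde_linked_def)
qed

lemma param_linked_block_recursion: "param_linked D X Yd Y' (block_recursion (param_block D X Yd Y'))"
  unfolding param_linked_def by (intro allI impI, subst block_recursion.simps) auto

lemma weyr_carrier [simp]: "weyr \<in> carrier_mat N N"
  by (simp add: weyr_def)

lemma centralizer_weyr_built_from:
  assumes "M \<in> centralizer weyr"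
  shows "\<exists>D X Yd Y' Y K. free_params s \<tau> n (centralizer C) D X Yd Y' \<and>
    built_from s \<tau> n D X Yd Y' Y K \<and> M = block_mat n (\<lambda>i. s * \<tau> i) K"
proof -
  have "M \<in> carrier_mat N N"
    using assms carrier_matD[OF weyr_carrier] by (simp add: centralizer_def)
  then obtain k where k: "supported k" and M: "M = assemble k" by (rule ex_blocks)
  then have "diagonally_linked k" "tilde_linked k"
    using assms assemble_in_centralizer_iff_linked[OF k] by simp_all
  then show ?thesis
    using params_of_blocks[OF k] built_from_blocks[OF k] M by metis
qed

lemma built_from_centralizer_weyr:
  assumes "free_params s \<tau> n (centralizer C) D X Yd Y'"
  shows "\<exists>M \<in> centralizer weyr. \<exists>Y K. built_from s \<tau> n D X Yd Y' Y K \<and> M = block_mat n (\<lambda>i. s * \<tau> i) K"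
proof -
  let ?k = "block_recursion (param_block D X Yd Y')"
  have "tilde_linked ?k" by (rule tilde_linked_block_recursion) (rule param_block_closed[OF assms])
  then have "assemble ?k \<in> centralizer weyr"
    by (simp add: assemble_in_centralizer_iff_linked supported_block_recursion diagonally_linked_block_recursion)
  then show ?thesis
    using built_from_blocks[OF supported_block_recursion diagonally_linked_block_recursion assms
        param_linked_block_recursion] by blast
qed

end


section \<open>The description of the centralizer\<close>

lemma conj_part_Suc_le: "conj_part \<alpha> (Suc i) \<le> conj_part \<alpha> i"
  unfolding conj_part_def by (rule card_mono) auto

lemma conj_part_zero:
  assumes "gen_segre \<alpha>" "hd \<alpha> < i"
  shows "conj_part \<alpha> i = 0"
proof -
  have "\<alpha> ! j \<le> hd \<alpha>" if "j < length \<alpha>" for j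
    using assms(1) that by (cases "j = 0") (auto simp: gen_segre_def hd_conv_nth sorted_wrt_iff_nth_less)
  then have "{j. j < length \<alpha> \<and> i \<le> \<alpha> ! j} = {}" using assms(2) by fastforce
  then show ?thesis unfolding conj_part_def by simp
qed

theorem theorem6p1:
  fixes p :: "'a::field poly" and \<alpha> :: "nat list" and s n :: nat and \<tau> :: "nat \<Rightarrow> nat"
    and C W :: "'a mat"
  assumes "irreducible p" and "lead_coeff p = 1" and "degree p = s"
    and "C = companion p"
    and "gen_segre \<alpha>" and "n = hd \<alpha>" and "\<tau> = conj_part \<alpha>"
    and "W = gen_weyr p \<alpha>"
  shows "(\<forall>M \<in> centralizer W. \<exists>D X Yd Y' Y K.
            free_params s \<tau> n (centralizer C) D X Yd Y' \<and>
            built_from s \<tau> n D X Yd Y' Y K \<and>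
            M = block_mat n (\<lambda>i. s * \<tau> i) K)
       \<and> (\<forall>D X Yd Y'.
            free_params s \<tau> n (centralizer C) D X Yd Y' \<longrightarrow>
            (\<exists>M \<in> centralizer W. \<exists>Y K.
               built_from s \<tau> n D X Yd Y' Y K \<and>
               M = block_mat n (\<lambda>i. s * \<tau> i) K))"
proof -
  have "0 < degree p"
  proof (rule ccontr)
    assume "\<not> 0 < degree p"
    with assms(1) have "is_unit p" by (auto simp: irreducible_def is_unit_iff_degree)
    with assms(1) show False by (simp add: irreducible_def)
  qed
  then interpret weyr_blocks p s \<tau> n
    using assms conj_part_Suc_le conj_part_zero by unfold_locales auto
  have "W = weyr"
  proof (rule mat_eq_by_pos)
    show "W \<in> carrier_mat N N"
      unfolding assms(8) gen_weyr_def Let_def assms(3) assms(6,7)[symmetric]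
      by (simp add: N_def carrier_matI)
    fix i u a j v b assume "inside i u a" "inside j v b"
    then show "W $$ (pos i u a, pos j v b) = weyr $$ (pos i u a, pos j v b)"
      unfolding assms(8) gen_weyr_def Let_def assms(3) assms(6,7)[symmetric]
        weyr_def assemble_def pos_def inside_def
      by (subst (1 2) block_mat_index) (auto simp: sblock_position_less)
  qed simp
  then show ?thesis
    using centralizer_weyr_built_from built_from_centralizer_weyr assms(4) by blast
qed

end
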